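(* Let $1\le p\le\infty$, $\sigma>0$, $f\in B^p_\sigma$, $h>0$, and $x_k=kh$ for $k\in\mathbb{Z}$. Then $$\|f\|_p\le \sup_{x\in\mathbb{R}}\Big(h\sum_{k\in\mathbb{Z}}|f(x-x_k)|^p\Big)^{1/p}\le (1+h\sigma)\|f\|_p .$$
   Context: $\|\cdot\|_p$ is the norm of $L_p(\mathbb{R})$ (complex-valued functions). For $\sigma>0$ and $1\le p\le\infty$, the Bernstein space $B^p_\sigma$ is the set of all $f\in L_p(\mathbb{R})\cap C^\infty(\mathbb{R})$ whose distributional Fourier transform has support in $[-\sigma,\sigma]$. The Fourier transform is $\mathcal{F}\varphi(\xi)=\frac{1}{\sqrt{2\pi}}\int_{\mathbb{R}}\varphi(x)e^{-ix\xi}dx$ for Schwartz functions $\varphi$, extended to tempered distributions by duality. For $p=\infty$ the middle expression is understood as $\sup_{x\in\mathbb{R}}\sup_{k\in\mathbb{Z}}|f(x-x_k)|$. *)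

theory Defs
  imports "HOL-Probability.Essential_Supremum"
begin

definition nderiv :: "nat \<Rightarrow> (real \<Rightarrow> complex) \<Rightarrow> real \<Rightarrow> complex" where
  "nderiv n = (\<lambda>g x. vector_derivative g (at x)) ^^ n"

definition smooth :: "(real \<Rightarrow> complex) \<Rightarrow> bool" where
  "smooth f \<longleftrightarrow> (\<forall>n x. nderiv n f differentiable (at x))"

(* Exponents p range over ennreal, with p = \<infinity> allowed, and norms are ennreal-valued,
   so that a divergent integral, series or supremum is genuinely \<infinity>. *)

(* Only meant for r > 0. *)
definition epowr :: "ennreal \<Rightarrow> real \<Rightarrow> ennreal" where
  "epowr a r = (if a = \<infinity> then \<infinity> else ennreal (enn2real a powr r))"

definition Lp_norm :: "ennreal \<Rightarrow> (real \<Rightarrow> complex) \<Rightarrow> ennreal" where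
  "Lp_norm p f =
    (if p = \<infinity> then esssup lborel (\<lambda>x. ennreal (norm (f x)))
     else epowr (\<integral>\<^sup>+ x. ennreal (norm (f x) powr enn2real p) \<partial>lborel) (1 / enn2real p))"

definition Lp_space :: "ennreal \<Rightarrow> (real \<Rightarrow> complex) set" where
  "Lp_space p = {f \<in> borel_measurable lborel. Lp_norm p f < \<infinity>}"

definition fourier :: "(real \<Rightarrow> complex) \<Rightarrow> real \<Rightarrow> complex" where
  "fourier \<phi> \<xi> = complex_of_real (1 / sqrt (2 * pi)) *
     (LINT x|lborel. \<phi> x * exp (- (\<i> * complex_of_real x * complex_of_real \<xi>)))"

(* Distributions are functionals on functions real => complex, of which only the values
   on Schwartz functions matter. For f in some L_p with p \<ge> 1 and \<phi> Schwartz,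
   the integrand below is integrable. *)
definition regular_distribution ::
    "(real \<Rightarrow> complex) \<Rightarrow> (real \<Rightarrow> complex) \<Rightarrow> complex" where
  "regular_distribution f \<phi> = (LINT x|lborel. f x * \<phi> x)"

definition fourier_distribution ::
    "((real \<Rightarrow> complex) \<Rightarrow> complex) \<Rightarrow> (real \<Rightarrow> complex) \<Rightarrow> complex" where
  "fourier_distribution T \<phi> = T (fourier \<phi>)"

definition fun_support :: "(real \<Rightarrow> complex) \<Rightarrow> real set" where
  "fun_support \<phi> = closure {x. \<phi> x \<noteq> 0}"

definition test_function :: "(real \<Rightarrow> complex) \<Rightarrow> bool" where
  "test_function \<phi> \<longleftrightarrow> smooth \<phi> \<and> compact (fun_support \<phi>)"

definition vanishes_on :: "((real \<Rightarrow> complex) \<Rightarrow> complex) \<Rightarrow> real set \<Rightarrow> bool" where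
  "vanishes_on T U \<longleftrightarrow> (\<forall>\<phi>. test_function \<phi> \<and> fun_support \<phi> \<subseteq> U \<longrightarrow> T \<phi> = 0)"

definition distribution_support :: "((real \<Rightarrow> complex) \<Rightarrow> complex) \<Rightarrow> real set" where
  "distribution_support T = - \<Union>{U. open U \<and> vanishes_on T U}"

definition bernstein :: "ennreal \<Rightarrow> real \<Rightarrow> (real \<Rightarrow> complex) set" where
  "bernstein p \<sigma> = {f \<in> Lp_space p. smooth f \<and>
     distribution_support (fourier_distribution (regular_distribution f)) \<subseteq> {-\<sigma>..\<sigma>}}"

definition sampling_sup ::
    "ennreal \<Rightarrow> real \<Rightarrow> (int \<Rightarrow> real) \<Rightarrow> (real \<Rightarrow> complex) \<Rightarrow> ennreal" where
  "sampling_sup p h t f =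
    (if p = \<infinity> then (SUP x. SUP k. ennreal (norm (f (x - t k))))
     else (SUP x. epowr (ennreal h *
            (\<Sum>\<^sub>\<infinity>k. ennreal (norm (f (x - t k)) powr enn2real p))) (1 / enn2real p)))"

end

theory Submission
  imports Defs "HOL-Probability.Sinc_Integral" "HOL-Probability.Characteristic_Functions"
begin

text \<open>The lower bound holds for every measurable function: integrate
  \<open>h \<Sum>\<^sub>k \<bar>f(x - kh)\<bar>\<^sup>p\<close> over a period. For the upper bound let first \<open>u\<close> be integrable with
  spectrum in \<open>[-s, s]\<close>. Fourier inversion and the Fourier series of the triangle wave give
  \<open>u'(y) = s \<Sum>\<^sub>n (-1)\<^sup>n w\<^sub>n (u(y + \<tau>\<^sub>n) - u(y - \<tau>\<^sub>n))\<close> with \<open>w\<^sub>n \<ge> 0\<close> and \<open>\<Sum>\<^sub>n w\<^sub>n = 1/2\<close>.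
  Since \<open>\<bar>u(a)\<bar>\<close> is at most the mean over \<open>[a, a + h)\<close> of \<open>\<bar>u\<bar> + h\<bar>u'\<bar>\<close>, it is at most
  \<open>1 + hs\<close> times an average of translates of \<open>\<bar>u\<bar>\<close>; Jensen's inequality for this average, summed
  over the sampling points, gives the constant \<open>(1 + hs)\<^sup>p\<close>. For general \<open>f\<close> apply this to
  \<open>u(x) = f(x) \<psi>(\<epsilon>x)\<close>, where \<open>\<psi>\<close> is the normalized Fourier transform of a nonnegative bump function
  supported in \<open>[-1, 1]\<close>: then \<open>\<bar>u\<bar> \<le> \<bar>f\<bar>\<close> and the spectrum of \<open>u\<close> lies in
  \<open>[-\<sigma> - \<epsilon>, \<sigma> + \<epsilon>]\<close>. Let \<open>\<epsilon> \<rightarrow> 0\<close>.\<close>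

section \<open>Smooth cut-off functions\<close>

text \<open>Two obstacles shape the upper bound. For \<open>p > 1\<close> a function of the space
  need not be integrable, so its spectrum is known only as the support of a distribution; and the
  constant has to be exactly \<open>1 + h * \<sigma>\<close> for every exponent. The first is met by
  the window: its transform is supported in a small interval, so it widens the spectrum by
  \<epsilon> only, and nonnegativity of the bump gives modulus at most 1, so no norm grows. The
  second is met by writing \<open>u'\<close> through translates of \<open>u\<close> of total weight
  \<open>s\<close>: translations preserve every norm, so all exponents are treated alike. The
  triangle wave appears because the \<open>2 * s\<close>-periodic extension of \<xi> jumps and has
  coefficients of order \<open>1 / n\<close> only, whereas reflecting it to period
  \<open>4 * s\<close> makes it continuous with summable coefficients. For
  \<open>p = \<infinity>\<close> both the norm and the sampled expression are the supremum of the
  modulus of the continuous function \<open>f\<close>, so the analysis concerns finite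
  exponents.\<close>

lemma nderiv_Suc: "nderiv (Suc n) f = nderiv n (\<lambda>x. vector_derivative f (at x))"
  by (simp add: nderiv_def funpow_Suc_right del: funpow.simps)

text \<open>Despite the name, the \<open>n\<close>-th derivative itself need not be continuous.\<close>
fun Ck :: "nat \<Rightarrow> (real \<Rightarrow> complex) \<Rightarrow> bool" where
  "Ck 0 f \<longleftrightarrow> True"
| "Ck (Suc n) f \<longleftrightarrow> (\<exists>f'. (\<forall>x. (f has_vector_derivative f' x) (at x)) \<and> Ck n f')"

lemma Ck_SucI:
  "(\<And>x. (f has_vector_derivative f' x) (at x)) \<Longrightarrow> Ck n f' \<Longrightarrow> Ck (Suc n) f"
  by auto

text \<open>Derivatives are unique, so only \<open>vector_derivative\<close> can witness the
  existential in \<open>Ck\<close>; \<open>nderiv_Suc\<close> peels derivatives in the same order.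
  The index shifts by one: \<open>Ck (Suc n)\<close> asks for \<open>n + 1\<close>
  derivatives.\<close>

lemma Ck_iff: "Ck (Suc n) f \<longleftrightarrow> (\<forall>m\<le>n. \<forall>x. nderiv m f differentiable (at x))"
proof (induction n arbitrary: f)
  case 0
  then show ?case
    by (auto simp: nderiv_def vector_derivative_works[symmetric] intro: differentiableI_vector
        intro!: exI[of _ "\<lambda>x. vector_derivative f (at x)"])
next
  case (Suc n)
  have *: "f' = (\<lambda>x. vector_derivative f (at x))"
    if "\<forall>x. (f has_vector_derivative f' x) (at x)" for f'
    by (rule ext) (rule vector_derivative_at[symmetric], rule that[rule_format])
  have "Ck (Suc (Suc n)) f \<longleftrightarrow> (\<forall>x. f differentiable (at x)) \<and>
    Ck (Suc n) (\<lambda>x. vector_derivative f (at x))"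
  proof
    assume "Ck (Suc (Suc n)) f"
    then obtain f' where "\<forall>x. (f has_vector_derivative f' x) (at x)" "Ck (Suc n) f'"
      unfolding Ck.simps(2)[of "Suc n"] by blast
    then show "(\<forall>x. f differentiable (at x)) \<and> Ck (Suc n) (\<lambda>x. vector_derivative f (at x))"
      using *[of f'] by (simp del: Ck.simps) (blast intro: differentiableI_vector)
  next
    assume "(\<forall>x. f differentiable (at x)) \<and> Ck (Suc n) (\<lambda>x. vector_derivative f (at x))"
    then show "Ck (Suc (Suc n)) f"
      using Ck_SucI[of f "\<lambda>x. vector_derivative f (at x)"] vector_derivative_works by blast
  qed
  also have "\<dots> \<longleftrightarrow> (\<forall>x. nderiv 0 f differentiable (at x)) \<and>
      (\<forall>m\<le>n. \<forall>x. nderiv (Suc m) f differentiable (at x))"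
    unfolding Suc.IH nderiv_Suc by (simp add: nderiv_def)
  also have "\<dots> \<longleftrightarrow> (\<forall>m\<le>Suc n. \<forall>x. nderiv m f differentiable (at x))"
    by (auto, case_tac m, auto)
  finally show ?case .
qed

lemma smooth_iff_Ck: "smooth f \<longleftrightarrow> (\<forall>n. Ck n f)"
proof
  assume "smooth f"
  then show "\<forall>n. Ck n f"
    by (intro allI, case_tac n) (simp_all add: Ck_iff smooth_def del: Ck.simps(2))
next
  assume "\<forall>n. Ck n f"
  then show "smooth f"
    unfolding smooth_def using Ck_iff by blast
qed

lemma Ck_SucD: "Ck (Suc n) f \<Longrightarrow> Ck n f"
proof (induction n arbitrary: f)
  case (Suc n)
  from Suc.prems obtain f' where "\<And>x. (f has_vector_derivative f' x) (at x)" "Ck (Suc n) f'"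
    unfolding Ck.simps(2)[of "Suc n"] by blast
  then show ?case
    using Suc.IH by (intro Ck_SucI)
qed simp

lemma Ck_const: "Ck n (\<lambda>x. c)"
  by (induction n arbitrary: c) (auto intro!: derivative_eq_intros)

lemma Ck_add: "Ck n f \<Longrightarrow> Ck n g \<Longrightarrow> Ck n (\<lambda>x. f x + g x)"
proof (induction n arbitrary: f g)
  case (Suc n)
  then obtain f' g' where "\<forall>x. (f has_vector_derivative f' x) (at x)" "Ck n f'"
    "\<forall>x. (g has_vector_derivative g' x) (at x)" "Ck n g'"
    by auto
  then show ?case
    using Suc.IH[of f' g'] by (auto intro!: exI[of _ "\<lambda>x. f' x + g' x"] derivative_intros)
qed simp

lemma Ck_mult: "Ck n f \<Longrightarrow> Ck n g \<Longrightarrow> Ck n (\<lambda>x. f x * g x)"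
proof (induction n arbitrary: f g)
  case (Suc n)
  then obtain f' g' where f': "\<forall>x. (f has_vector_derivative f' x) (at x)" "Ck n f'"
    and g': "\<forall>x. (g has_vector_derivative g' x) (at x)" "Ck n g'"
    by auto
  have "Ck n (\<lambda>x. f x * g' x + f' x * g x)"
    using Suc f' g' Ck_SucD by (intro Ck_add Suc.IH) auto
  moreover have "((\<lambda>x. f x * g x) has_vector_derivative f x * g' x + f' x * g x) (at x)" for x
    using f' g' by (auto intro: has_vector_derivative_mult)
  ultimately show ?case by (rule Ck_SucI[rotated])
qed simp

lemma Ck_inverse: "Ck n f \<Longrightarrow> (\<And>x. f x \<noteq> 0) \<Longrightarrow> Ck n (\<lambda>x. inverse (f x))"
proof (induction n arbitrary: f)
  case (Suc n)
  then obtain f' where f': "\<forall>x. (f has_vector_derivative f' x) (at x)" "Ck n f'"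
    by auto
  have *: "Ck n (\<lambda>x. inverse (f x))"
    using Suc Ck_SucD by blast
  have "Ck n (\<lambda>x. (-1) * (f' x * (inverse (f x) * inverse (f x))))"
    by (intro Ck_mult Ck_const f' *)
  moreover have "((\<lambda>x. inverse (f x)) has_vector_derivative
      (-1) * (f' x * (inverse (f x) * inverse (f x)))) (at x)" for x
    using field_vector_diff_chain_at[of f "f' x" x inverse "- (inverse (f x) * inverse (f x))"]
      f' Suc.prems(2) DERIV_inverse[of "f x" UNIV]
    by (simp add: o_def power2_eq_square)
  ultimately show ?case by (rule Ck_SucI[rotated])
qed simp

lemma Ck_affine: "Ck n f \<Longrightarrow> Ck n (\<lambda>x. f (a * x + b))"
proof (induction n arbitrary: f)
  case (Suc n)
  then obtain f' where f': "\<forall>x. (f has_vector_derivative f' x) (at x)" "Ck n f'"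
    by auto
  have "Ck n (\<lambda>x. of_real a * f' (a * x + b))"
    by (intro Ck_mult Ck_const Suc.IH f')
  moreover have "((\<lambda>x. f (a * x + b)) has_vector_derivative of_real a * f' (a * x + b)) (at x)" for x
  proof -
    have "((\<lambda>x. a * x + b) has_vector_derivative a) (at x)"
      by (auto intro!: derivative_eq_intros simp: has_real_derivative_iff_has_vector_derivative[symmetric])
    from vector_diff_chain_at[OF this f'(1)[rule_format]] show ?thesis
      by (simp add: o_def scaleR_conv_of_real)
  qed
  ultimately show ?case by (rule Ck_SucI[rotated])
qed simp

text \<open>The exponent \<open>k\<close> makes the span of this family closed under
  differentiation, so a single induction yields all derivatives of the flat function
  \<open>exp (- 1 / x)\<close>.\<close>

definition exp_tail :: "nat \<Rightarrow> real \<Rightarrow> real" where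
  "exp_tail k x = (if x > 0 then inverse x ^ k * exp (- inverse x) else 0)"

lemma exp_tail_tendsto_0: "(exp_tail k \<longlongrightarrow> 0) (at 0)"
proof -
  have "((\<lambda>y::real. y ^ k / exp y) \<longlongrightarrow> 0) at_top"
    by (rule tendsto_power_div_exp_0)
  then have "((\<lambda>x::real. inverse x ^ k / exp (inverse x)) \<longlongrightarrow> 0) (at_right 0)"
    by (rule filterlim_compose) (rule filterlim_inverse_at_top_right)
  then have "(exp_tail k \<longlongrightarrow> 0) (at_right 0)"
    by (rule Lim_transform_eventually)
      (auto simp: eventually_at_right_field exp_tail_def exp_minus field_simps intro: exI[of _ 1])
  moreover have "(exp_tail k \<longlongrightarrow> 0) (at_left 0)"
    by (rule tendsto_eventually) (auto simp: eventually_at_left_field exp_tail_def intro: exI[of _ "-1"])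
  ultimately show ?thesis
    by (simp add: filterlim_split_at)
qed

lemma DERIV_exp_tail:
  "(exp_tail k has_real_derivative exp_tail (k + 2) x - real k * exp_tail (Suc k) x) (at x)"
proof -
  consider "x > 0" | "x < 0" | "x = 0" by linarith
  then show ?thesis
  proof cases
    case 1
    have "((\<lambda>y. inverse y ^ k * exp (- inverse y)) has_real_derivative
        real k * inverse x ^ (k - 1) * (- (inverse x * inverse x)) * exp (- inverse x)
        + inverse x ^ k * (inverse x * inverse x * exp (- inverse x))) (at x)"
      using 1 by (auto intro!: derivative_eq_intros simp: algebra_simps)
    moreover have "real k * inverse x ^ (k - 1) * (- (inverse x * inverse x)) * exp (- inverse x)
        + inverse x ^ k * (inverse x * inverse x * exp (- inverse x))
        = exp_tail (k + 2) x - real k * exp_tail (Suc k) x"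
      using 1 by (cases k) (simp_all add: exp_tail_def algebra_simps)
    ultimately have "((\<lambda>x. inverse x ^ k * exp (- inverse x)) has_real_derivative
        exp_tail (k + 2) x - real k * exp_tail (Suc k) x) (at x)"
      by (simp only:)
    then show ?thesis
      by (rule has_field_derivative_transform_within_open[of _ _ _ "{0<..}"])
        (use 1 in \<open>auto simp: exp_tail_def\<close>)
  next
    case 2
    have "((\<lambda>x. 0) has_real_derivative exp_tail (k + 2) x - real k * exp_tail (Suc k) x) (at x)"
      using 2 by (auto simp: exp_tail_def)
    then show ?thesis
      by (rule has_field_derivative_transform_within_open[of _ _ _ "{..<0}"])
        (use 2 in \<open>auto simp: exp_tail_def\<close>)
  next
    case 3
    \<comment> \<open>The difference quotient of \<open>exp_tail k\<close> at 0 is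
      \<open>exp_tail (Suc k)\<close> itself.\<close>
    have "((\<lambda>y. (exp_tail k y - exp_tail k 0) / (y - 0)) \<longlongrightarrow> 0) (at 0)"
      by (rule Lim_transform_eventually[OF exp_tail_tendsto_0[of "Suc k"]])
        (auto simp: eventually_at exp_tail_def field_simps intro!: exI[of _ 1])
    then show ?thesis
      using 3 by (simp add: has_field_derivative_iff exp_tail_def)
  qed
qed

lemma Ck_exp_tail: "Ck n (\<lambda>x. of_real (exp_tail k x))"
proof (induction n arbitrary: k)
  case (Suc n)
  have "Ck n (\<lambda>x. of_real (exp_tail (k + 2) x) + (- of_nat k) * of_real (exp_tail (Suc k) x))"
    by (intro Ck_add Ck_mult Ck_const Suc.IH)
  moreover have "((\<lambda>x. complex_of_real (exp_tail k x)) has_vector_derivative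
      of_real (exp_tail (k + 2) x) + (- of_nat k) * of_real (exp_tail (Suc k) x)) (at x)" for x
    using has_vector_derivative_of_real[OF DERIV_exp_tail[of k x]]
    by simp
  ultimately show ?case by (rule Ck_SucI[rotated])
qed simp

definition smooth_step :: "real \<Rightarrow> real" where
  "smooth_step x = exp_tail 0 x / (exp_tail 0 x + exp_tail 0 (1 - x))"

text \<open>The arguments \<open>x\<close> and \<open>1 - x\<close> are never both
  nonpositive.\<close>

lemma exp_tail_add_pos: "exp_tail 0 x + exp_tail 0 (1 - x) > 0"
  by (auto simp: exp_tail_def add_pos_pos)

lemma smooth_step_eq_0: "x \<le> 0 \<Longrightarrow> smooth_step x = 0"
  and smooth_step_eq_1: "x \<ge> 1 \<Longrightarrow> smooth_step x = 1"
  by (auto simp: smooth_step_def exp_tail_def)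

lemma Ck_smooth_step: "Ck n (\<lambda>x. of_real (smooth_step x))"
proof -
  have eq: "(\<lambda>x. complex_of_real (smooth_step x)) = (\<lambda>x. of_real (exp_tail 0 x) *
      inverse (of_real (exp_tail 0 x) + of_real (exp_tail 0 ((-1) * x + 1))))"
    by (auto simp: smooth_step_def divide_inverse)
  have "complex_of_real (exp_tail 0 x) + of_real (exp_tail 0 ((-1) * x + 1)) \<noteq> 0" for x
    using exp_tail_add_pos[of x] by (simp flip: of_real_add)
  then show ?thesis
    unfolding eq by (intro Ck_mult Ck_inverse Ck_add Ck_exp_tail Ck_affine[of n "\<lambda>x. of_real (exp_tail 0 x)"])
qed

definition bump :: "real \<Rightarrow> real" where
  "bump x = exp_tail 0 (1 + x) * exp_tail 0 (1 - x)"

lemma bump_nonneg: "bump x \<ge> 0"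
  by (simp add: bump_def exp_tail_def)

lemma bump_pos: "\<bar>x\<bar> < 1 \<Longrightarrow> bump x > 0"
  by (simp add: bump_def exp_tail_def)

lemma bump_eq_0: "\<bar>x\<bar> \<ge> 1 \<Longrightarrow> bump x = 0"
  by (auto simp: bump_def exp_tail_def)

lemma Ck_bump: "Ck n (\<lambda>x. of_real (bump x))"
  using Ck_mult[OF Ck_affine[OF Ck_exp_tail, of n 0 1 1] Ck_affine[OF Ck_exp_tail, of n 0 "-1" 1]]
  by (simp add: bump_def add.commute)

section \<open>Fourier transforms of test functions and localization\<close>

lemma smooth_continuous_on: "smooth f \<Longrightarrow> continuous_on S f"
proof -
  assume "smooth f"
  then have "Ck 1 f" by (simp add: smooth_iff_Ck)
  then obtain f' where "\<And>x. (f has_vector_derivative f' x) (at x)" by auto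
  then show ?thesis
    by (meson continuous_at_imp_continuous_on has_vector_derivative_continuous)
qed

lemma fun_support_subset: "closed S \<Longrightarrow> (\<And>x. x \<notin> S \<Longrightarrow> f x = 0) \<Longrightarrow> fun_support f \<subseteq> S"
  unfolding fun_support_def by (rule closure_minimal) auto

lemma eq_0_outside_fun_support: "x \<notin> fun_support f \<Longrightarrow> f x = 0"
  unfolding fun_support_def using closure_subset[of "{x. f x \<noteq> 0}"] by auto

lemma test_functionI:
  assumes "\<And>n. Ck n \<phi>" "\<And>x. x \<notin> {a..b} \<Longrightarrow> \<phi> x = 0"
  shows "test_function \<phi>"
proof -
  have "bounded {x. \<phi> x \<noteq> 0}"
    by (rule bounded_subset[OF bounded_closed_interval[of a b]]) (use assms(2) in blast)
  then show ?thesis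
    using assms(1) by (simp add: test_function_def smooth_iff_Ck fun_support_def compact_closure)
qed

lemma test_function_bounded_support:
  assumes "test_function \<phi>"
  obtains R where "R > 0" "\<And>x. \<bar>x\<bar> \<ge> R \<Longrightarrow> \<phi> x = 0"
proof -
  have "bounded (fun_support \<phi>)"
    using assms by (simp add: test_function_def compact_imp_bounded)
  then obtain R where "R > 0" "\<And>x. x \<in> fun_support \<phi> \<Longrightarrow> norm x < R"
    by (auto simp: bounded_pos_less)
  then show thesis
    by (intro that[of R]) (auto simp: not_le[symmetric] intro!: eq_0_outside_fun_support)
qed

section \<open>Integrability, transforms of derivatives, and quadratic decay\<close>

lemma integrable_compact_support:
  fixes \<phi> :: "real \<Rightarrow> complex"
  assumes "continuous_on UNIV \<phi>" "\<And>x. x \<notin> {a..b} \<Longrightarrow> \<phi> x = 0"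
  shows "integrable lborel \<phi>"
proof -
  have "(\<lambda>x. indicator {a..b} x *\<^sub>R \<phi> x) = \<phi>"
    using assms(2) by (auto simp: indicator_def)
  then show ?thesis
    using borel_integrable_compact[of "{a..b}" \<phi>] assms(1) by (auto intro: continuous_on_subset)
qed

lemma integrable_test_function:
  assumes "test_function \<phi>"
  shows "integrable lborel \<phi>"
proof -
  obtain R where R: "R > 0" "\<And>x. \<bar>x\<bar> \<ge> R \<Longrightarrow> \<phi> x = 0"
    using assms test_function_bounded_support by blast
  have "continuous_on UNIV \<phi>"
    using assms by (simp add: test_function_def smooth_continuous_on)
  then show ?thesis
    by (rule integrable_compact_support[of \<phi> "- R" R]) (rule R(2), auto)
qed

lemma norm_exp_ii [simp]: "norm (exp (- (\<i> * complex_of_real x * complex_of_real \<xi>))) = 1"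
  by (metis mult.assoc mult_minus_right norm_exp_i_times of_real_minus of_real_mult)

lemma integrable_mult_character:
  assumes "integrable lborel \<phi>"
  shows "integrable lborel (\<lambda>x. \<phi> x * exp (- (\<i> * complex_of_real x * complex_of_real \<xi>)))"
  by (rule Bochner_Integration.integrable_bound[OF assms])
    (use assms in \<open>auto simp: norm_mult intro!: borel_measurable_times dest: borel_measurable_integrable\<close>)

lemma norm_fourier_le:
  assumes "integrable lborel \<phi>"
  shows "norm (fourier \<phi> \<xi>) \<le> (LINT x|lborel. norm (\<phi> x)) / sqrt (2 * pi)"
proof -
  have "norm (LINT x|lborel. \<phi> x * exp (- (\<i> * complex_of_real x * complex_of_real \<xi>)))
      \<le> (LINT x|lborel. norm (\<phi> x * exp (- (\<i> * complex_of_real x * complex_of_real \<xi>))))"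
    by (rule integral_norm_bound)
  then have "norm (LINT x|lborel. \<phi> x * exp (- (\<i> * complex_of_real x * complex_of_real \<xi>)))
      \<le> (LINT x|lborel. norm (\<phi> x))"
    by (simp add: norm_mult)
  then show ?thesis
    unfolding fourier_def norm_mult by (simp add: norm_divide divide_right_mono)
qed

lemma continuous_fourier:
  assumes "integrable lborel \<phi>"
  shows "continuous_on UNIV (fourier \<phi>)"
proof -
  have "isCont (\<lambda>\<xi>. LINT x|lborel. \<phi> x * exp (- (\<i> * complex_of_real x * complex_of_real \<xi>))) \<xi>" for \<xi>
    unfolding continuous_at_sequentially
  proof (intro allI impI)
    fix s assume "s \<longlonglongrightarrow> \<xi>"
    then show "((\<lambda>\<xi>. LINT x|lborel. \<phi> x * exp (- (\<i> * complex_of_real x * complex_of_real \<xi>))) \<circ> s) \<longlonglongrightarrow>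
        (LINT x|lborel. \<phi> x * exp (- (\<i> * complex_of_real x * complex_of_real \<xi>)))"
      unfolding o_def using assms
      by (intro integral_dominated_convergence[where w = "\<lambda>x. norm (\<phi> x)"])
        (auto simp: norm_mult intro!: borel_measurable_times tendsto_intros dest: borel_measurable_integrable)
  qed
  then show ?thesis
    unfolding fourier_def by (intro continuous_intros continuous_at_imp_continuous_on) auto
qed

text \<open>Integration by parts on \<open>{-R..R}\<close>, where the boundary values of
  \<open>\<phi>\<close> vanish. The second conclusion hands the same radius to
  \<open>\<phi>'\<close>, so that the lemma can be iterated; at the two end points it follows from
  continuity of \<open>\<phi>'\<close>.\<close>

lemma fourier_deriv:
  assumes \<phi>: "\<And>x. (\<phi> has_vector_derivative \<phi>' x) (at x)" and \<phi>': "continuous_on UNIV \<phi>'"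
    and zero: "\<And>x. \<bar>x\<bar> \<ge> R \<Longrightarrow> \<phi> x = 0" and R: "R > 0"
  shows "fourier \<phi>' \<xi> = \<i> * of_real \<xi> * fourier \<phi> \<xi>"
    and "\<And>x. \<bar>x\<bar> \<ge> R \<Longrightarrow> \<phi>' x = 0"
proof -
  define E where "E x = exp (- (\<i> * complex_of_real x * complex_of_real \<xi>))" for x
  have zero': "\<phi>' x = 0" if "\<bar>x\<bar> > R" for x
  proof -
    have "((\<lambda>x. 0) has_vector_derivative \<phi>' x) (at x)"
      by (rule has_vector_derivative_transform_within_open[OF \<phi>, of "- {-R..R}"])
        (use that zero in auto)
    from vector_derivative_unique_at[OF this has_vector_derivative_const] show ?thesis .
  qed
  have cont: "(\<phi>' \<longlongrightarrow> \<phi>' y) (at y)" for y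
    using \<phi>' by (simp add: continuous_on_eq_continuous_at isCont_def)
  have "\<phi>' R = 0"
  proof (rule tendsto_unique[of "at_right R" \<phi>'])
    show "(\<phi>' \<longlongrightarrow> \<phi>' R) (at_right R)"
      using cont by (rule tendsto_within_subset) simp
    show "(\<phi>' \<longlongrightarrow> 0) (at_right R)"
      by (rule tendsto_eventually) (use zero' R in \<open>auto simp: eventually_at_right_field intro!: exI[of _ "R + 1"]\<close>)
  qed auto
  moreover have "\<phi>' (- R) = 0"
  proof (rule tendsto_unique[of "at_left (-R)" \<phi>'])
    show "(\<phi>' \<longlongrightarrow> \<phi>' (- R)) (at_left (-R))"
      using cont by (rule tendsto_within_subset) simp
    show "(\<phi>' \<longlongrightarrow> 0) (at_left (-R))"
      by (rule tendsto_eventually) (use zero' R in \<open>auto simp: eventually_at_left_field intro!: exI[of _ "- R - 1"]\<close>)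
  qed auto
  ultimately show zero': "\<And>x. \<bar>x\<bar> \<ge> R \<Longrightarrow> \<phi>' x = 0"
    using zero' by (metis abs_eq_iff' abs_of_pos R order_le_less)
  have \<phi>c: "continuous_on UNIV \<phi>"
    using \<phi> by (meson continuous_at_imp_continuous_on has_vector_derivative_continuous)
  have int: "integrable lborel \<phi>" "integrable lborel \<phi>'"
    by (rule integrable_compact_support[OF \<phi>c, of "-R" R], rule zero, force)
      (rule integrable_compact_support[OF \<phi>', of "-R" R], rule zero', force)
  have E: "(E has_vector_derivative - (\<i> * \<xi>) * E x) (at x)" for x
  proof -
    have "((\<lambda>z. exp (- (\<i> * z * complex_of_real \<xi>))) has_field_derivative - (\<i> * \<xi>) * E x) (at (complex_of_real x))"
      unfolding E_def by (auto intro!: derivative_eq_intros)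
    then show ?thesis
      unfolding E_def using has_vector_derivative_real_field by blast
  qed
  have Ec: "continuous_on UNIV E"
    using E by (meson continuous_at_imp_continuous_on has_vector_derivative_continuous)
  have d: "((\<lambda>x. \<phi> x * E x) has_vector_derivative \<phi> x * (- (\<i> * \<xi>) * E x) + \<phi>' x * E x) (at x)" for x
    using \<phi> E by (rule has_vector_derivative_mult)
  have "continuous_on {-R..R} (\<lambda>x. \<phi> x * (- (\<i> * \<xi>) * E x) + \<phi>' x * E x)"
    by (rule continuous_on_subset[of UNIV], intro continuous_on_add continuous_on_mult
        continuous_on_const \<phi>c \<phi>' Ec) simp
  then have "(LINT x|lborel. indicator {-R..R} x *\<^sub>R (\<phi> x * (- (\<i> * \<xi>) * E x) + \<phi>' x * E x)) = \<phi> R * E R - \<phi> (-R) * E (-R)"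
    by (rule integral_FTC_Icc[rotated 2]) (use R in simp, rule has_vector_derivative_at_within[OF d])
  also have "(\<lambda>x. indicator {-R..R} x *\<^sub>R (\<phi> x * (- (\<i> * \<xi>) * E x) + \<phi>' x * E x)) =
    (\<lambda>x. \<phi>' x * E x - (\<i> * \<xi>) * (\<phi> x * E x))"
  proof
    fix x
    show "indicator {-R..R} x *\<^sub>R (\<phi> x * (- (\<i> * \<xi>) * E x) + \<phi>' x * E x) =
      \<phi>' x * E x - (\<i> * \<xi>) * (\<phi> x * E x)"
    proof (cases "x \<in> {-R..R}")
      case False
      then have "\<bar>x\<bar> \<ge> R" by auto
      then show ?thesis using zero zero' by simp
    qed (simp add: algebra_simps)
  qed
  also have "integral\<^sup>L lborel \<dots> = (LINT x|lborel. \<phi>' x * E x) - (\<i> * \<xi>) * (LINT x|lborel. \<phi> x * E x)"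
    using int[THEN integrable_mult_character, of \<xi>] unfolding E_def by simp
  finally have "(LINT x|lborel. \<phi>' x * E x) = (\<i> * \<xi>) * (LINT x|lborel. \<phi> x * E x)"
    using zero[of R] zero[of "-R"] R by simp
  then show "fourier \<phi>' \<xi> = \<i> * of_real \<xi> * fourier \<phi> \<xi>"
    unfolding fourier_def E_def by simp
qed

text \<open>Two derivatives bound \<open>\<xi>\<^sup>2 * norm (fourier \<phi> \<xi>)\<close>; adding
  the trivial bound on \<open>norm (fourier \<phi> \<xi>)\<close> gives the factor
  \<open>1 + \<xi>\<^sup>2\<close>, which removes the singularity at 0.\<close>

lemma fourier_test_function_decay:
  assumes "test_function \<phi>"
  obtains C where "\<And>\<xi>. norm (fourier \<phi> \<xi>) \<le> C / (1 + \<xi>\<^sup>2)"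
proof -
  obtain R where R: "R > 0" "\<And>x. \<bar>x\<bar> \<ge> R \<Longrightarrow> \<phi> x = 0"
    using assms test_function_bounded_support by blast
  \<comment> \<open>Two derivatives are used, but the second must be continuous; this comes from the
    existence of a third.\<close>
  have "Ck 3 \<phi>"
    using assms by (simp add: test_function_def smooth_iff_Ck)
  then obtain \<phi>1 \<phi>2 \<phi>3 where d1: "\<And>x. (\<phi> has_vector_derivative \<phi>1 x) (at x)"
    and d2: "\<And>x. (\<phi>1 has_vector_derivative \<phi>2 x) (at x)"
    and d3: "\<And>x. (\<phi>2 has_vector_derivative \<phi>3 x) (at x)"
    by (auto simp: numeral_3_eq_3)
  have c: "continuous_on UNIV \<phi>1" "continuous_on UNIV \<phi>2"
    using d2 d3 by (meson continuous_at_imp_continuous_on has_vector_derivative_continuous)+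
  note f1 = fourier_deriv[OF d1 c(1) R(2,1)]
  note f2 = fourier_deriv[OF d2 c(2) f1(2) R(1)]
  have "integrable lborel \<phi>2"
    using c(2) by (rule integrable_compact_support[of _ "-R" R]) (use f2(2) in force)
  from norm_fourier_le[OF this]
  have *: "\<xi>\<^sup>2 * norm (fourier \<phi> \<xi>) \<le> (LINT x|lborel. norm (\<phi>2 x)) / sqrt (2 * pi)" for \<xi>
    by (simp add: f1(1) f2(1) norm_mult power2_eq_square mult.assoc[symmetric])
  define C where "C = (LINT x|lborel. norm (\<phi> x)) / sqrt (2 * pi) + (LINT x|lborel. norm (\<phi>2 x)) / sqrt (2 * pi)"
  have "norm (fourier \<phi> \<xi>) \<le> C / (1 + \<xi>\<^sup>2)" for \<xi>
    using *[of \<xi>] norm_fourier_le[OF integrable_test_function[OF assms], of \<xi>]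
    by (subst pos_le_divide_eq) (auto simp: algebra_simps C_def add_pos_nonneg)
  then show thesis by (rule that)
qed

lemma integrable_inverse_1_plus_square': "integrable lborel (\<lambda>x::real. 1 / (1 + x\<^sup>2))"
  using integrable_inverse_1_plus_square by (simp add: set_integrable_def inverse_eq_divide)

text \<open>\<open>t \<le> 1 + t\<^sup>r\<close> replaces Hoelder's inequality here.\<close>
lemma integrable_mult_decay:
  fixes f g :: "real \<Rightarrow> complex"
  assumes f: "f \<in> borel_measurable lborel" "integrable lborel (\<lambda>x. norm (f x) powr r)" "r \<ge> 1"
    and g: "g \<in> borel_measurable lborel" "\<And>x. norm (g x) \<le> C / (1 + x\<^sup>2)"
  shows "integrable lborel (\<lambda>x. f x * g x)"
proof (rule Bochner_Integration.integrable_bound)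
  show "integrable lborel (\<lambda>x. C * (1 / (1 + x\<^sup>2)) + C * norm (f x) powr r)"
    using f integrable_inverse_1_plus_square'
    by (intro Bochner_Integration.integrable_add integrable_mult_right) auto
  show "AE x in lborel. norm (f x * g x) \<le> norm (C * (1 / (1 + x\<^sup>2)) + C * norm (f x) powr r)"
  proof (rule AE_I2)
    fix x
    have t: "norm (f x) \<le> 1 + norm (f x) powr r"
    proof (cases "norm (f x) \<le> 1")
      case False
      then have "norm (f x) powr 1 \<le> norm (f x) powr r"
        using f(3) by (intro powr_mono) auto
      then show ?thesis using False by simp
    qed (simp add: add_increasing2)
    have C: "0 \<le> C"
      using order_trans[OF norm_ge_zero g(2)[of 0]] by simp
    have "norm (f x * g x) \<le> (1 + norm (f x) powr r) * (C / (1 + x\<^sup>2))"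
      unfolding norm_mult using t g(2)[of x] by (intro mult_mono) auto
    also have "\<dots> = C * (1 / (1 + x\<^sup>2)) + norm (f x) powr r * (C / (1 + x\<^sup>2))"
      by (simp add: algebra_simps add_divide_distrib)
    also have "\<dots> \<le> C * (1 / (1 + x\<^sup>2)) + norm (f x) powr r * C"
      using C mult_left_mono[of 1 "1 + x\<^sup>2" C]
      by (intro add_left_mono mult_left_mono) (auto simp: divide_le_eq add_pos_nonneg)
    finally show "norm (f x * g x) \<le> norm (C * (1 / (1 + x\<^sup>2)) + C * norm (f x) powr r)"
      by (simp add: mult.commute)
  qed
qed (use f g in measurable)

lemma integrable_mult_fourier:
  assumes "f \<in> borel_measurable lborel" "integrable lborel (\<lambda>x. norm (f x) powr r)" "r \<ge> 1"
    and "test_function \<phi>"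
  shows "integrable lborel (\<lambda>x. f x * fourier \<phi> x)"
proof -
  obtain C where "\<And>\<xi>. norm (fourier \<phi> \<xi>) \<le> C / (1 + \<xi>\<^sup>2)"
    using fourier_test_function_decay[OF assms(4)] by blast
  moreover have "fourier \<phi> \<in> borel_measurable lborel"
    using continuous_fourier[OF integrable_test_function[OF assms(4)]]
    by (simp add: borel_measurable_continuous_onI)
  ultimately show ?thesis
    using assms by (intro integrable_mult_decay)
qed

lemma fourier_sum:
  assumes "\<And>k. k \<in> K \<Longrightarrow> integrable lborel (\<phi> k)"
  shows "fourier (\<lambda>x. \<Sum>k\<in>K. \<phi> k x) \<xi> = (\<Sum>k\<in>K. fourier (\<phi> k) \<xi>)"
  using assms
  by (simp add: fourier_def sum_distrib_right sum_distrib_left Bochner_Integration.integral_sum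
      integrable_mult_character)

text \<open>The Bochner integral is additive on integrable summands, non-integrable ones having the
  default value 0; \<open>integrable_mult_fourier\<close> guarantees that the pairings are genuine
  integrals.\<close>

lemma fourier_distribution_sum:
  assumes f: "f \<in> borel_measurable lborel" "integrable lborel (\<lambda>x. norm (f x) powr r)" "r \<ge> 1"
    and \<phi>: "\<And>k. k \<in> K \<Longrightarrow> test_function (\<phi> k)"
  shows "fourier_distribution (regular_distribution f) (\<lambda>x. \<Sum>k\<in>K. \<phi> k x) =
    (\<Sum>k\<in>K. fourier_distribution (regular_distribution f) (\<phi> k))"
proof -
  have "fourier (\<lambda>x. \<Sum>k\<in>K. \<phi> k x) = (\<lambda>\<xi>. \<Sum>k\<in>K. fourier (\<phi> k) \<xi>)"
    using fourier_sum[of K \<phi>] integrable_test_function \<phi> by blast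
  then show ?thesis
    unfolding fourier_distribution_def regular_distribution_def
    using integrable_mult_fourier[OF f] \<phi>
    by (simp add: sum_distrib_left Bochner_Integration.integral_sum)
qed

text \<open>Vanishing is only known locally; it is globalised by cutting \<open>\<phi>\<close> with the partition of
  unity formed by the differences of successive translates of \<^const>\<open>smooth_step\<close>.\<close>
lemma fourier_distribution_eq_0:
  assumes f: "f \<in> borel_measurable lborel" "integrable lborel (\<lambda>x. norm (f x) powr r)" "r \<ge> 1"
    and \<phi>: "test_function \<phi>"
    and disj: "distribution_support (fourier_distribution (regular_distribution f)) \<inter> fun_support \<phi> = {}"
  shows "fourier_distribution (regular_distribution f) \<phi> = 0"
proof -
  define T where "T = fourier_distribution (regular_distribution f)"
  define G where "G = {U. open U \<and> vanishes_on T U}"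
  have "fun_support \<phi> \<subseteq> \<Union>G"
    using disj unfolding distribution_support_def T_def G_def by blast
  moreover have "compact (fun_support \<phi>)"
    using \<phi> by (simp add: test_function_def)
  \<comment> \<open>\<open>e\<close> is a Lebesgue number for the cover of the compact support by
    open sets on which \<open>T\<close> vanishes.\<close>
  ultimately obtain e where e: "e > 0" "\<And>x. x \<in> fun_support \<phi> \<Longrightarrow> \<exists>U\<in>G. ball x e \<subseteq> U"
    using Heine_Borel_lemma[of "fun_support \<phi>" G] unfolding G_def by blast
  obtain R where R: "R > 0" "\<And>x. \<bar>x\<bar> \<ge> R \<Longrightarrow> \<phi> x = 0"
    using \<phi> test_function_bounded_support by blast
  \<comment> \<open>Each piece of the partition lives on an interval of length
    \<open>2 * d < e\<close>, which therefore lies in \<open>ball x e\<close> as soon as it contains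
    \<open>x\<close>.\<close>
  define d where "d = e / 3"
  have d: "d > 0" using e by (simp add: d_def)
  obtain N :: nat where N: "2 * R / d + 1 \<le> real N"
    using real_arch_simple by blast
  \<comment> \<open>The offset \<open>+ 1\<close> makes \<open>c 0\<close> equal to 1 to the right
    of \<open>- R\<close>, and the choice of \<open>N\<close> makes \<open>c N\<close> vanish to the
    left of \<open>R\<close>, so the differences telescope to 1 wherever \<open>\<phi>\<close> can
    be nonzero.\<close>
  define c where "c k x = smooth_step ((x + R) / d + 1 - real k)" for k :: nat and x
  define \<psi> where "\<psi> k x = \<phi> x * of_real (c k x - c (Suc k) x)" for k x
  have step: "\<phi> x = (\<Sum>k<N. \<psi> k x)" for x
  proof (cases "\<bar>x\<bar> \<ge> R")
    case False
    have "c 0 x = 1"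
      unfolding c_def using False d by (intro smooth_step_eq_1) (auto simp: field_simps)
    moreover have "(x + R) / d \<le> 2 * R / d"
      using False d by (intro divide_right_mono) auto
    then have "c N x = 0"
      unfolding c_def using N by (intro smooth_step_eq_0) auto
    ultimately show ?thesis
      using sum_lessThan_telescope'[of "\<lambda>k. c k x" N]
      by (simp add: \<psi>_def sum_distrib_left[symmetric] del: of_real_diff flip: of_real_sum)
  qed (simp add: \<psi>_def R)
  have Ckc: "Ck n (\<lambda>x. of_real (c k x))" for n k
    using Ck_affine[OF Ck_smooth_step[of n], of "1 / d" "R / d + 1 - real k"]
    by (simp add: c_def add_divide_distrib algebra_simps)
  have "Ck n (\<lambda>x. \<phi> x * (of_real (c k x) + (-1) * of_real (c (Suc k) x)))" for n k
    using \<phi> Ckc by (intro Ck_mult Ck_add Ck_const) (auto simp: test_function_def smooth_iff_Ck)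
  then have Ck\<psi>: "Ck n (\<psi> k)" for n k
    unfolding \<psi>_def by simp
  have test: "test_function (\<psi> k)" for k
    by (rule test_functionI[OF Ck\<psi>, of "-R" R]) (use R in \<open>auto simp: \<psi>_def\<close>)
  have T\<psi>: "T (\<psi> k) = 0" for k
  proof -
    define I where "I = {(real k - 1) * d - R .. (real k + 1) * d - R}"
    have "c k x - c (Suc k) x = 0" if "x \<notin> I" for x
    proof -
      consider "(x + R) / d \<le> real k - 1" | "(x + R) / d \<ge> real k + 1"
        using \<open>x \<notin> I\<close> d by (fastforce simp: I_def field_simps)
      then show ?thesis
        unfolding c_def by cases (simp_all add: smooth_step_eq_0 smooth_step_eq_1)
    qed
    then have s: "fun_support (\<psi> k) \<subseteq> I"
      by (intro fun_support_subset) (auto simp: \<psi>_def I_def)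
    show ?thesis
    proof (cases "fun_support \<phi> \<inter> I = {}")
      case True
      then have "\<psi> k = (\<lambda>x. 0)"
        using s eq_0_outside_fun_support[of _ "\<psi> k"] eq_0_outside_fun_support[of _ \<phi>]
        by (fastforce simp: \<psi>_def)
      then show ?thesis
        by (simp add: T_def fourier_distribution_def regular_distribution_def fourier_def)
    next
      case False
      then obtain x where x: "x \<in> fun_support \<phi>" "x \<in> I" by blast
      then obtain U where U: "U \<in> G" "ball x e \<subseteq> U" using e by blast
      have "I \<subseteq> ball x e"
        using x(2) d by (auto simp: I_def d_def dist_real_def abs_less_iff algebra_simps)
      then show ?thesis
        using U s test unfolding G_def vanishes_on_def by blast
    qed
  qed
  have "T \<phi> = T (\<lambda>x. \<Sum>k<N. \<psi> k x)"
    using step by presburger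
  also have "\<dots> = (\<Sum>k<N. T (\<psi> k))"
    unfolding T_def by (rule fourier_distribution_sum[OF f test])
  finally show ?thesis
    using T\<psi> T_def by simp
qed

section \<open>Fourier inversion\<close>

lemma std_normal_integrable: "integrable lborel std_normal_density"
  using integrable_std_normal_moment[of 0] by simp

lemma std_normal_integral: "integral\<^sup>L lborel std_normal_density = 1"
  using integral_std_normal_moment_even[of 0] by simp

text \<open>Follows from \<open>v\<^sup>2 / 2 \<le> exp (v\<^sup>2 / 2)\<close>. Quadratic decay
  makes the rescaled kernel of order \<open>1 / n\<close> away from its centre.\<close>

lemma std_normal_density_le_inverse_square:
  assumes "v \<noteq> 0"
  shows "std_normal_density v \<le> 2 / v\<^sup>2"
proof -
  have "v\<^sup>2 / 2 \<le> exp (v\<^sup>2 / 2)"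
    using exp_ge_add_one_self[of "v\<^sup>2 / 2"] by linarith
  then have "exp (- v\<^sup>2 / 2) \<le> 2 / v\<^sup>2"
    using assms by (simp add: exp_minus field_simps)
  moreover have "1 / sqrt (2 * pi) \<le> 1"
    using pi_ge_two by (simp add: divide_le_eq)
  then have "std_normal_density v \<le> 1 * exp (- v\<^sup>2 / 2)"
    unfolding std_normal_density_def by (intro mult_right_mono) auto
  ultimately show ?thesis by simp
qed

lemma std_normal_density_le_1: "std_normal_density v \<le> 1"
proof -
  have "1 / sqrt (2 * pi) \<le> 1"
    using pi_ge_two by (simp add: divide_le_eq)
  then have "std_normal_density v \<le> 1 * 1"
    unfolding std_normal_density_def by (intro mult_mono) auto
  then show ?thesis by simp
qed

text \<open>The Gaussian is its own Fourier transform: the characteristic function of the standard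
  normal law is \<open>sqrt (2 * pi)\<close> times its density. The scale \<open>d\<close> enters by
  substitution.\<close>

lemma integral_std_normal_character:
  assumes "d > 0"
  shows "(LINT \<xi>|lborel. of_real (std_normal_density (d * \<xi>)) * exp (\<i> * of_real (a * \<xi>))) =
    complex_of_real (sqrt (2 * pi) / d * std_normal_density (a / d))"
proof -
  have "(LINT x|lborel. of_real (std_normal_density x) * exp (\<i> * of_real ((a / d) * x)))
      = char std_normal_distribution (a / d)"
    unfolding char_def by (subst integral_density) (auto simp: scaleR_conv_of_real)
  also have "\<dots> = of_real (sqrt (2 * pi) * std_normal_density (a / d))"
    unfolding char_std_normal_distribution by (simp add: std_normal_density_def)
  finally have *: "(LINT x|lborel. of_real (std_normal_density x) * exp (\<i> * of_real ((a / d) * x)))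
      = complex_of_real (sqrt (2 * pi) * std_normal_density (a / d))" .
  have "(LINT x|lborel. of_real (std_normal_density x) * exp (\<i> * of_real ((a / d) * x)))
    = \<bar>d\<bar> *\<^sub>R (LINT x|lborel. of_real (std_normal_density (0 + d * x)) * exp (\<i> * of_real ((a / d) * (0 + d * x))))"
    using assms by (intro lborel_integral_real_affine) simp
  also have "\<dots> = d *\<^sub>R (LINT x|lborel. of_real (std_normal_density (d * x)) * exp (\<i> * of_real (a * x)))"
    using assms by simp
  finally show ?thesis
    using assms * by (simp add: scaleR_conv_of_real field_simps)
qed

text \<open>\<open>u\<close> is continuous and integrable but possibly unbounded, so the unit
  neighbourhood \<open>I\<close> of \<open>x\<close> is separated from its complement. On
  \<open>I\<close> the function is bounded, and dominated convergence applies after zooming in by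
  \<open>y = x - z / (n + 1)\<close>; off \<open>I\<close> the kernel is uniformly of order
  \<open>1 / n\<close>, and integrability of \<open>u\<close> suffices.\<close>

lemma approximate_identity_std_normal:
  fixes u :: "real \<Rightarrow> complex"
  assumes u: "continuous_on UNIV u" "integrable lborel u"
  shows "(\<lambda>n. LINT y|lborel. u y * of_real (real (Suc n) * std_normal_density (real (Suc n) * (x - y)))) \<longlonglongrightarrow> u x"
proof -
  define K where "K n y = real (Suc n) * std_normal_density (real (Suc n) * (x - y))" for n y
  define I where "I = {x - 1<..<x + 1}"
  have K0: "K n y \<ge> 0" for n y
    by (simp add: K_def)
  have [measurable]: "u \<in> borel_measurable borel"
    using u(1) by (rule borel_measurable_continuous_onI)
  have [measurable]: "K n \<in> borel_measurable borel" for n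
    unfolding K_def by measurable
  have [measurable]: "I \<in> sets borel" by (simp add: I_def)
  have Kint: "integrable lborel (\<lambda>y. u y * of_real (K n y))" for n
  proof (rule Bochner_Integration.integrable_bound)
    show "integrable lborel (\<lambda>y. real (Suc n) * norm (u y))"
      using u by auto
    show "AE y in lborel. norm (u y * of_real (K n y)) \<le> norm (real (Suc n) * norm (u y))"
    proof (rule AE_I2)
      fix y
      have "norm (u y) * K n y \<le> norm (u y) * (real (Suc n) * 1)"
        unfolding K_def by (intro mult_left_mono std_normal_density_le_1) auto
      then show "norm (u y * of_real (K n y)) \<le> norm (real (Suc n) * norm (u y))"
        using K0[of n y] by (simp add: norm_mult mult.commute)
    qed
  qed measurable
  have near: "(\<lambda>n. LINT y|lborel. indicator I y *\<^sub>R (u y * of_real (K n y))) \<longlonglongrightarrow> u x"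
  proof -
    have aff: "(LINT y|lborel. indicator I y *\<^sub>R (u y * of_real (K n y))) =
      (LINT z|lborel. indicator I (x - z / real (Suc n)) *\<^sub>R (u (x - z / real (Suc n)) * of_real (std_normal_density z)))" for n
    proof -
      have "(LINT y|lborel. indicator I y *\<^sub>R (u y * of_real (K n y))) = \<bar>- (1 / real (Suc n))\<bar> *\<^sub>R
        (LINT z|lborel. indicator I (x + - (1 / real (Suc n)) * z) *\<^sub>R (u (x + - (1 / real (Suc n)) * z) * of_real (K n (x + - (1 / real (Suc n)) * z))))"
        by (rule lborel_integral_real_affine) simp
      also have "\<dots> = (LINT z|lborel. \<bar>- (1 / real (Suc n))\<bar> *\<^sub>R
        (indicator I (x + - (1 / real (Suc n)) * z) *\<^sub>R (u (x + - (1 / real (Suc n)) * z) * of_real (K n (x + - (1 / real (Suc n)) * z)))))"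
        by (rule integral_scaleR_right[symmetric])
      also have "\<dots> = (LINT z|lborel. indicator I (x - z / real (Suc n)) *\<^sub>R (u (x - z / real (Suc n)) * of_real (std_normal_density z)))"
        using of_nat_neq_0[of n, where 'a = complex]
        by (intro Bochner_Integration.integral_cong) (simp_all add: K_def scaleR_conv_of_real del: of_nat_Suc)
      finally show ?thesis .
    qed
    have "compact (u ` {x-1..x+1})"
      using u(1) by (intro compact_continuous_image) (auto intro: continuous_on_subset)
    then obtain B where "\<forall>z \<in> u ` {x-1..x+1}. norm z \<le> B"
      using compact_imp_bounded[of "u ` {x-1..x+1}"] unfolding bounded_iff by blast
    then have B: "\<And>y. y \<in> {x-1..x+1} \<Longrightarrow> norm (u y) \<le> B"
      by blast
    have "(\<lambda>n. LINT z|lborel. indicator I (x - z / real (Suc n)) *\<^sub>R (u (x - z / real (Suc n)) * of_real (std_normal_density z)))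
        \<longlonglongrightarrow> (LINT z|lborel. u x * of_real (std_normal_density z))"
    proof (rule integral_dominated_convergence[where w = "\<lambda>z. B * std_normal_density z"])
      show "AE z in lborel. (\<lambda>n. indicator I (x - z / real (Suc n)) *\<^sub>R (u (x - z / real (Suc n)) * of_real (std_normal_density z)))
          \<longlonglongrightarrow> u x * of_real (std_normal_density z)"
      proof (rule AE_I2)
        fix z
        have l: "(\<lambda>n. x - z / real (Suc n)) \<longlonglongrightarrow> x - 0"
          by (intro tendsto_diff tendsto_const LIMSEQ_Suc lim_const_over_n)
        moreover have "open I" "x \<in> I" by (auto simp: I_def)
        ultimately have "\<forall>\<^sub>F n in sequentially. x - z / real (Suc n) \<in> I"
          by (simp add: topological_tendstoD)
        then have ev: "\<forall>\<^sub>F n in sequentially. u (x - z / real (Suc n)) * of_real (std_normal_density z) =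
            indicator I (x - z / real (Suc n)) *\<^sub>R (u (x - z / real (Suc n)) * of_real (std_normal_density z))"
          by eventually_elim simp
        have "isCont u x"
          using u(1) by (simp add: continuous_on_eq_continuous_at)
        then have "(\<lambda>n. u (x - z / real (Suc n))) \<longlonglongrightarrow> u x"
          by (rule isCont_tendsto_compose) (use l in simp)
        then have "(\<lambda>n. u (x - z / real (Suc n)) * of_real (std_normal_density z)) \<longlonglongrightarrow> u x * of_real (std_normal_density z)"
          by (intro tendsto_mult tendsto_const)
        then show "(\<lambda>n. indicator I (x - z / real (Suc n)) *\<^sub>R (u (x - z / real (Suc n)) * of_real (std_normal_density z)))
          \<longlonglongrightarrow> u x * of_real (std_normal_density z)"
          using ev by (rule Lim_transform_eventually)
      qed
      show "AE z in lborel. norm (indicator I (x - z / real (Suc n)) *\<^sub>R (u (x - z / real (Suc n)) * of_real (std_normal_density z)))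
        \<le> B * std_normal_density z" for n
      proof (rule AE_I2)
        fix z
        have "norm (indicator I w *\<^sub>R (u w * of_real (std_normal_density z))) \<le> B * std_normal_density z" for w
        proof (cases "w \<in> I")
          case True
          then have "norm (u w) * std_normal_density z \<le> B * std_normal_density z"
            by (intro mult_right_mono B) (auto simp: I_def)
          with True show ?thesis by (simp add: norm_mult)
        next
          case False
          have "B \<ge> 0" using order_trans[OF norm_ge_zero B[of x]] by simp
          with False show ?thesis by simp
        qed
        then show "norm (indicator I (x - z / real (Suc n)) *\<^sub>R (u (x - z / real (Suc n)) * of_real (std_normal_density z)))
        \<le> B * std_normal_density z" .
      qed
    qed (use std_normal_integrable in simp_all)
    also have "(LINT z|lborel. u x * of_real (std_normal_density z)) = u x"
      using std_normal_integral by simp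
    finally show ?thesis
      unfolding aff .
  qed
  have far: "(\<lambda>n. LINT y|lborel. indicator (- I) y *\<^sub>R (u y * of_real (K n y))) \<longlonglongrightarrow> 0"
  proof (rule Lim_null_comparison)
    show "\<forall>\<^sub>F n in sequentially. norm (LINT y|lborel. indicator (- I) y *\<^sub>R (u y * of_real (K n y)))
        \<le> (2 * (LINT y|lborel. norm (u y))) / real (Suc n)"
    proof (rule always_eventually, rule allI)
      fix n
      have "norm (LINT y|lborel. indicator (- I) y *\<^sub>R (u y * of_real (K n y))) \<le>
         (LINT y|lborel. norm (indicator (- I) y *\<^sub>R (u y * of_real (K n y))))"
        by (rule integral_norm_bound)
      also have "\<dots> \<le> (LINT y|lborel. (2 / real (Suc n)) * norm (u y))"
      proof (rule integral_mono)
        show "integrable lborel (\<lambda>y. norm (indicator (- I) y *\<^sub>R (u y * of_real (K n y))))"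
          by (rule integrable_norm, rule integrable_mult_indicator[OF _ Kint]) simp
        show "integrable lborel (\<lambda>y. (2 / real (Suc n)) * norm (u y))"
          using u by auto
        show "norm (indicator (- I) y *\<^sub>R (u y * of_real (K n y))) \<le> (2 / real (Suc n)) * norm (u y)" for y
        proof (cases "y \<in> I")
          case False
          then have y: "\<bar>x - y\<bar> \<ge> 1" by (auto simp: I_def)
          then have y2: "(x - y)\<^sup>2 \<ge> 1"
            using abs_le_square_iff[of 1 "x - y"] by simp
          have "K n y \<le> real (Suc n) * (2 / (real (Suc n) * (x - y))\<^sup>2)"
            unfolding K_def using y by (intro mult_left_mono std_normal_density_le_inverse_square) auto
          also have "\<dots> = (2 / real (Suc n)) / (x - y)\<^sup>2"
            by (simp add: power_mult_distrib power2_eq_square del: of_nat_Suc)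
          also have "\<dots> \<le> (2 / real (Suc n)) / 1"
            using y2 by (intro divide_left_mono) auto
          finally have "norm (u y) * K n y \<le> norm (u y) * (2 / real (Suc n))"
            by (intro mult_left_mono) auto
          with False K0[of n y] show ?thesis by (simp add: norm_mult mult.commute)
        qed simp
      qed
      finally show "norm (LINT y|lborel. indicator (- I) y *\<^sub>R (u y * of_real (K n y)))
        \<le> (2 * (LINT y|lborel. norm (u y))) / real (Suc n)" by simp
    qed
    show "(\<lambda>n. (2 * (LINT y|lborel. norm (u y))) / real (Suc n)) \<longlonglongrightarrow> 0"
      by (intro LIMSEQ_Suc lim_const_over_n)
  qed
  have "(LINT y|lborel. indicator I y *\<^sub>R (u y * of_real (K n y))) + (LINT y|lborel. indicator (- I) y *\<^sub>R (u y * of_real (K n y)))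
     = (LINT y|lborel. u y * of_real (K n y))" for n
  proof -
    have "(LINT y|lborel. indicator I y *\<^sub>R (u y * of_real (K n y))) + (LINT y|lborel. indicator (- I) y *\<^sub>R (u y * of_real (K n y)))
     = (LINT y|lborel. indicator I y *\<^sub>R (u y * of_real (K n y)) + indicator (- I) y *\<^sub>R (u y * of_real (K n y)))"
      by (rule Bochner_Integration.integral_add[symmetric]) (rule integrable_mult_indicator[OF _ Kint], simp)+
    also have "\<dots> = (LINT y|lborel. u y * of_real (K n y))"
      by (rule Bochner_Integration.integral_cong) (auto simp: indicator_def)
    finally show ?thesis .
  qed
  with tendsto_add[OF near far] show ?thesis
    by (simp add: K_def)
qed


text \<open>A Gaussian factor in \<xi> makes the double integral absolutely convergent. Exchanging
  the integrals turns the damped inversion integral into the convolution of \<open>u\<close> with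
  the Gaussian approximate identity; the damping is then removed on both sides.\<close>

lemma fourier_inversion:
  assumes u: "continuous_on UNIV u" "integrable lborel u"
    and F: "continuous_on UNIV (fourier u)" "integrable lborel (fourier u)"
  shows "u x = of_real (1 / sqrt (2 * pi)) * (LINT \<xi>|lborel. fourier u \<xi> * exp (\<i> * of_real (x * \<xi>)))"
proof (rule LIMSEQ_unique)
  define c where "c = complex_of_real (1 / sqrt (2 * pi))"
  \<comment> \<open>Since \<open>std_normal_density 0 = 1 / sqrt (2 * pi)\<close>, the damping
    factor leaves in the limit exactly the constant of the inversion formula.\<close>
  define I where "I n = (LINT \<xi>|lborel. fourier u \<xi> * exp (\<i> * of_real (x * \<xi>)) *
      of_real (std_normal_density (\<xi> / real (Suc n))))" for n
  have [measurable]: "u \<in> borel_measurable borel" "fourier u \<in> borel_measurable borel"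
    using u(1) F(1) by (auto intro: borel_measurable_continuous_onI)
  have expn: "norm (exp (\<i> * complex_of_real a)) = 1" for a by simp
  show "I \<longlonglongrightarrow> of_real (1 / sqrt (2 * pi)) * (LINT \<xi>|lborel. fourier u \<xi> * exp (\<i> * of_real (x * \<xi>)))"
  proof -
    have "I \<longlonglongrightarrow> (LINT \<xi>|lborel. fourier u \<xi> * exp (\<i> * of_real (x * \<xi>)) * of_real (std_normal_density 0))"
      unfolding I_def
    proof (rule integral_dominated_convergence[where w = "\<lambda>\<xi>. norm (fourier u \<xi>)"])
      show "AE \<xi> in lborel. (\<lambda>n. fourier u \<xi> * exp (\<i> * of_real (x * \<xi>)) *
          of_real (std_normal_density (\<xi> / real (Suc n))))
          \<longlonglongrightarrow> fourier u \<xi> * exp (\<i> * of_real (x * \<xi>)) * of_real (std_normal_density 0)"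
      proof (rule AE_I2)
        fix \<xi> :: real
        have "(\<lambda>n. \<xi> / real (Suc n)) \<longlonglongrightarrow> 0"
          by (intro LIMSEQ_Suc lim_const_over_n)
        then have "(\<lambda>n. 1 / sqrt (2 * pi) * exp (- (\<xi> / real (Suc n))\<^sup>2 / 2)) \<longlonglongrightarrow> 1 / sqrt (2 * pi) * exp (- 0\<^sup>2 / 2)"
          by (intro tendsto_intros) auto
        then show "(\<lambda>n. fourier u \<xi> * exp (\<i> * of_real (x * \<xi>)) * of_real (std_normal_density (\<xi> / real (Suc n))))
          \<longlonglongrightarrow> fourier u \<xi> * exp (\<i> * of_real (x * \<xi>)) * of_real (std_normal_density 0)"
          unfolding std_normal_density_def by (rule tendsto_mult[OF tendsto_const tendsto_of_real])
      qed
      show "AE \<xi> in lborel. norm (fourier u \<xi> * exp (\<i> * of_real (x * \<xi>)) *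
          of_real (std_normal_density (\<xi> / real (Suc n)))) \<le> norm (fourier u \<xi>)" for n
        using std_normal_density_le_1 by (intro AE_I2) (simp add: norm_mult mult_left_le)
    qed (use F(2) in simp_all)
    also have "(LINT \<xi>|lborel. fourier u \<xi> * exp (\<i> * of_real (x * \<xi>)) * of_real (std_normal_density 0))
        = of_real (1 / sqrt (2 * pi)) * (LINT \<xi>|lborel. fourier u \<xi> * exp (\<i> * of_real (x * \<xi>)))"
      by (simp add: std_normal_density_def)
    finally show ?thesis .
  qed
  have "I n = (LINT y|lborel. u y * of_real (real (Suc n) * std_normal_density (real (Suc n) * (x - y))))" for n
  proof -
    define N where "N \<xi> = complex_of_real (std_normal_density (1 / real (Suc n) * \<xi>))" for \<xi>
    define G where "G \<xi> y = N \<xi> * u y * exp (\<i> * of_real ((x - y) * \<xi>))" for \<xi> y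
    have Nm [measurable]: "N \<in> borel_measurable borel"
      unfolding N_def by measurable
    have N: "integrable lborel N"
      using lborel_integrable_real_affine[OF std_normal_integrable, of "1 / real (Suc n)" 0]
      unfolding N_def by simp
    have normG: "norm (G \<xi> y) = norm (N \<xi>) * norm (u y)" for \<xi> y
      unfolding G_def norm_mult expn by simp
    have "integrable (lborel \<Otimes>\<^sub>M lborel) (case_prod G)"
    proof (rule lborel_pair.Fubini_integrable)
      show "case_prod G \<in> borel_measurable (lborel \<Otimes>\<^sub>M lborel)"
        unfolding G_def by measurable
      show "integrable lborel (\<lambda>\<xi>. LINT y|lborel. norm (case (\<xi>, y) of (x, xa) \<Rightarrow> G x xa))"
        using N by (simp add: normG)
      have Gm: "G \<xi> \<in> borel_measurable lborel" for \<xi>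
        unfolding G_def by measurable
      have "integrable lborel (G \<xi>)" for \<xi>
        by (rule Bochner_Integration.integrable_bound[of _ "\<lambda>y. norm (N \<xi>) * norm (u y)"])
          (use u(2) Gm in \<open>auto simp: normG\<close>)
      then show "AE \<xi> in lborel. integrable lborel (\<lambda>y. case (\<xi>, y) of (x, xa) \<Rightarrow> G x xa)"
        by simp
    qed
    then have fub: "(LINT y|lborel. LINT \<xi>|lborel. G \<xi> y) = (LINT \<xi>|lborel. LINT y|lborel. G \<xi> y)"
      by (rule lborel_pair.Fubini_integral)
    have "I n = (LINT \<xi>|lborel. c * (LINT y|lborel. G \<xi> y))"
      unfolding I_def
    proof (rule Bochner_Integration.integral_cong)
      fix \<xi>
      have G: "G \<xi> y = (u y * exp (- (\<i> * of_real y * of_real \<xi>))) * (exp (\<i> * of_real (x * \<xi>)) * N \<xi>)" for y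
      proof -
        have "exp (\<i> * of_real ((x - y) * \<xi>)) = exp (- (\<i> * of_real y * of_real \<xi>)) * exp (\<i> * complex_of_real (x * \<xi>))"
          unfolding exp_add[symmetric] by (rule arg_cong[of _ _ exp]) (simp add: algebra_simps)
        then show ?thesis by (simp add: G_def mult_ac)
      qed
      have "(LINT y|lborel. G \<xi> y) = (LINT y|lborel. u y * exp (- (\<i> * of_real y * of_real \<xi>))) * (exp (\<i> * of_real (x * \<xi>)) * N \<xi>)"
        unfolding G by (rule integral_mult_left_zero)
      then show "fourier u \<xi> * exp (\<i> * of_real (x * \<xi>)) * of_real (std_normal_density (\<xi> / real (Suc n)))
          = c * (LINT y|lborel. G \<xi> y)"
        unfolding fourier_def c_def N_def by (simp add: mult_ac)
    qed simp
    also have "\<dots> = c * (LINT y|lborel. LINT \<xi>|lborel. G \<xi> y)"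
      unfolding fub by simp
    also have "\<dots> = c * (LINT y|lborel. u y * of_real (sqrt (2 * pi) / (1 / real (Suc n)) * std_normal_density ((x - y) / (1 / real (Suc n)))))"
    proof -
      have "(LINT \<xi>|lborel. G \<xi> y) = u y * of_real (sqrt (2 * pi) / (1 / real (Suc n)) * std_normal_density ((x - y) / (1 / real (Suc n))))" for y
      proof -
        have "(LINT \<xi>|lborel. G \<xi> y) = (LINT \<xi>|lborel. u y * (N \<xi> * exp (\<i> * of_real ((x - y) * \<xi>))))"
          unfolding G_def by (rule Bochner_Integration.integral_cong) (simp_all add: mult_ac)
        also have "\<dots> = u y * (LINT \<xi>|lborel. N \<xi> * exp (\<i> * of_real ((x - y) * \<xi>)))"
          by (rule integral_mult_right_zero)
        finally show ?thesis
          unfolding N_def by (subst (asm) integral_std_normal_character) simp_all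
      qed
      then show ?thesis by simp
    qed
    also have "\<dots> = (LINT y|lborel. c * (u y * of_real (sqrt (2 * pi) / (1 / real (Suc n)) * std_normal_density ((x - y) / (1 / real (Suc n))))))"
      by (rule integral_mult_right_zero[symmetric])
    also have "\<dots> = (LINT y|lborel. u y * of_real (real (Suc n) * std_normal_density (real (Suc n) * (x - y))))"
    proof (rule Bochner_Integration.integral_cong)
      fix y
      have "complex_of_real (sqrt (2 * pi)) \<noteq> 0" by simp
      then show "c * (u y * of_real (sqrt (2 * pi) / (1 / real (Suc n)) * std_normal_density ((x - y) / (1 / real (Suc n)))))
        = u y * of_real (real (Suc n) * std_normal_density (real (Suc n) * (x - y)))"
        unfolding c_def by (simp add: mult_ac del: of_nat_Suc of_real_of_nat_eq)
    qed simp
    finally show ?thesis .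
  qed
  then have "I = (\<lambda>n. LINT y|lborel. u y * of_real (real (Suc n) * std_normal_density (real (Suc n) * (x - y))))"
    by (rule ext)
  then show "I \<longlonglongrightarrow> u x"
    using approximate_identity_std_normal[OF u] by (simp only:)
qed

section \<open>The Fourier series of the triangle wave\<close>

lemma summable_inverse_odd_squares: "summable (\<lambda>n. 1 / (real (2 * n + 1))\<^sup>2)"
proof (rule summable_comparison_test')
  show "summable (\<lambda>n. 1 / real (Suc n) ^ 2)"
    using inverse_power_summable[of 2, where 'a = real]
    by (subst summable_Suc_iff[of "\<lambda>n. 1 / real n ^ 2"]) (simp add: inverse_eq_divide)
  show "norm (1 / (real (2 * n + 1))\<^sup>2) \<le> 1 / real (Suc n) ^ 2" for n
    by (auto intro!: divide_left_mono power_mono)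
qed

text \<open>The termwise derivative of the sine series does not converge absolutely at
  \<open>r = 1\<close>; the Abel factor repairs this for \<open>r < 1\<close>. Its exponent equals
  the frequency, so that both combine into odd powers of
  \<open>of_real r * cis \<theta>\<close>.\<close>

definition abel_triangle :: "real \<Rightarrow> real \<Rightarrow> real" where
  "abel_triangle r \<theta> = (\<Sum>n. (-1) ^ n * r ^ (2 * n + 1) * sin (real (2 * n + 1) * \<theta>) / (real (2 * n + 1))\<^sup>2)"

lemma norm_abel_triangle_term_le:
  assumes "0 \<le> r" "r \<le> 1"
  shows "norm ((-1) ^ n * r ^ (2 * n + 1) * sin (real (2 * n + 1) * \<theta>) / (real (2 * n + 1))\<^sup>2) \<le> 1 / (real (2 * n + 1))\<^sup>2"
proof -
  have "r ^ (2 * n + 1) * \<bar>sin (real (2 * n + 1) * \<theta>)\<bar> \<le> 1 * 1"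
    using assms by (intro mult_mono power_le_one abs_sin_le_one) auto
  then show ?thesis
    using assms by (simp add: abs_mult power_abs divide_right_mono del: power_Suc)
qed

lemma summable_abel_triangle:
  assumes "0 \<le> r" "r \<le> 1"
  shows "summable (\<lambda>n. (-1) ^ n * r ^ (2 * n + 1) * sin (real (2 * n + 1) * \<theta>) / (real (2 * n + 1))\<^sup>2)"
  by (rule summable_comparison_test'[OF summable_inverse_odd_squares norm_abel_triangle_term_le[OF assms]])

lemma continuous_on_abel_triangle: "continuous_on {0..1} (\<lambda>r. abel_triangle r \<theta>)"
  unfolding abel_triangle_def
proof (rule uniform_limit_theorem)
  show "uniform_limit {0..1}
     (\<lambda>N r. \<Sum>n<N. (-1) ^ n * r ^ (2 * n + 1) * sin (real (2 * n + 1) * \<theta>) / (real (2 * n + 1))\<^sup>2)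
     (\<lambda>r. \<Sum>n. (-1) ^ n * r ^ (2 * n + 1) * sin (real (2 * n + 1) * \<theta>) / (real (2 * n + 1))\<^sup>2) sequentially"
    by (rule Weierstrass_m_test[OF norm_abel_triangle_term_le summable_inverse_odd_squares]) auto
  show "\<forall>\<^sub>F N in sequentially. continuous_on {0..1} (\<lambda>r. \<Sum>n<N. (-1) ^ n * r ^ (2 * n + 1) * sin (real (2 * n + 1) * \<theta>) / (real (2 * n + 1))\<^sup>2)"
    by (intro always_eventually allI continuous_intros) auto
qed simp

lemma continuous_on_abel_triangle_1: "continuous_on UNIV (abel_triangle 1)"
  unfolding abel_triangle_def
proof (rule uniform_limit_theorem)
  show "uniform_limit UNIV
     (\<lambda>N \<theta>. \<Sum>n<N. (-1) ^ n * 1 ^ (2 * n + 1) * sin (real (2 * n + 1) * \<theta>) / (real (2 * n + 1))\<^sup>2)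
     (\<lambda>\<theta>. \<Sum>n. (-1) ^ n * 1 ^ (2 * n + 1) * sin (real (2 * n + 1) * \<theta>) / (real (2 * n + 1))\<^sup>2) sequentially"
    by (rule Weierstrass_m_test[OF norm_abel_triangle_term_le summable_inverse_odd_squares]) auto
  show "\<forall>\<^sub>F N in sequentially. continuous_on UNIV (\<lambda>\<theta>. \<Sum>n<N. (-1) ^ n * 1 ^ (2 * n + 1) * sin (real (2 * n + 1) * \<theta>) / (real (2 * n + 1))\<^sup>2)"
    by (intro always_eventually allI continuous_intros) auto
qed simp

text \<open>Termwise differentiation removes one factor \<open>2 * n + 1\<close> and leaves the real
  part of the power series of \<open>Arctan\<close>; the geometric majorant in \<open>r\<close>
  justifies it.\<close>

lemma DERIV_abel_triangle:
  assumes r: "0 \<le> r" "r < 1"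
  shows "(abel_triangle r has_real_derivative Re (Arctan (of_real r * cis \<theta>))) (at \<theta>)"
proof -
  define f where "f n \<theta> = (-1) ^ n * r ^ (2 * n + 1) * sin (real (2 * n + 1) * \<theta>) / (real (2 * n + 1))\<^sup>2" for n \<theta>
  define f' where "f' n \<theta> = (-1) ^ n * r ^ (2 * n + 1) * cos (real (2 * n + 1) * \<theta>) / real (2 * n + 1)" for n \<theta>
  have d: "(f n has_real_derivative f' n \<theta>) (at \<theta>)" for n \<theta>
    unfolding f_def f'_def
    by (rule derivative_eq_intros refl | simp add: power2_eq_square)+
  have summable_r: "summable (\<lambda>n. r ^ (2 * n + 1))"
  proof (rule summable_comparison_test'[of "\<lambda>n. r ^ n"])
    show "summable (\<lambda>n. r ^ n)" using r by (intro summable_geometric) auto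
    show "norm (r ^ (2 * n + 1)) \<le> r ^ n" for n
      using r by (simp add: power_abs power_decreasing del: power_Suc)
  qed
  have "norm (f' n \<theta>) \<le> r ^ (2 * n + 1)" for n \<theta>
  proof -
    have "r ^ (2 * n + 1) * (\<bar>cos (real (2 * n + 1) * \<theta>)\<bar> / real (2 * n + 1)) \<le> r ^ (2 * n + 1) * 1"
      using r order_trans[OF abs_cos_le_one[of "real (2 * n + 1) * \<theta>"], of "real (2 * n + 1)"]
      by (intro mult_left_mono) (simp_all add: divide_le_eq)
    then show ?thesis
      using r by (simp add: f'_def abs_mult power_abs del: power_Suc)
  qed
  then have "uniform_limit UNIV (\<lambda>N \<theta>. \<Sum>n<N. f' n \<theta>) (\<lambda>\<theta>. \<Sum>n. f' n \<theta>) sequentially"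
    by (intro Weierstrass_m_test[OF _ summable_r])
  moreover have "summable (\<lambda>n. f n 0)"
    unfolding f_def using r by (intro summable_abel_triangle) auto
  ultimately obtain g where g: "\<And>x. (\<lambda>n. f n x) sums g x"
      "\<And>x. (g has_real_derivative (\<Sum>n. f' n x)) (at x)"
    using has_field_derivative_series[of UNIV f f' "\<lambda>\<theta>. \<Sum>n. f' n \<theta>" 0] d by auto
  have "g = abel_triangle r"
    using g(1) by (auto simp: abel_triangle_def f_def sums_iff)
  moreover have "(\<lambda>n. f' n \<theta>) sums Re (Arctan (of_real r * cis \<theta>))"
  proof -
    have "norm (of_real r * cis \<theta>) < 1" using r by (simp add: norm_mult)
    from sums_Re[OF Arctan_series(2)[OF this]]
    have "(\<lambda>n. Re ((- 1) ^ n / of_nat (2 * n + 1) * (complex_of_real r * cis \<theta>) ^ (2 * n + 1))) sums Re (Arctan (of_real r * cis \<theta>))" .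
    moreover have "Re ((- 1) ^ n / of_nat (2 * n + 1) * (complex_of_real r * cis \<theta>) ^ (2 * n + 1)) = f' n \<theta>" for n
    proof -
      have "(- 1) ^ n / of_nat (2 * n + 1) * (complex_of_real r * cis \<theta>) ^ (2 * n + 1)
        = of_real ((-1) ^ n / real (2 * n + 1) * r ^ (2 * n + 1)) * cis (real (2 * n + 1) * \<theta>)"
      proof -
        have "(complex_of_real r * cis \<theta>) ^ (2 * n + 1) = of_real r ^ (2 * n + 1) * cis (real (2 * n + 1) * \<theta>)"
          by (simp only: power_mult_distrib Complex.DeMoivre)
        then show ?thesis by (simp only: of_real_mult of_real_divide of_real_power of_real_minus of_real_1 of_real_of_nat_eq mult.assoc)
      qed
      then have "Re ((- 1) ^ n / of_nat (2 * n + 1) * (complex_of_real r * cis \<theta>) ^ (2 * n + 1))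
        = Re (of_real ((-1) ^ n / real (2 * n + 1) * r ^ (2 * n + 1)) * cis (real (2 * n + 1) * \<theta>))"
        by (rule arg_cong)
      then show ?thesis
        unfolding f'_def by (simp only: times_complex.sel Re_complex_of_real Im_complex_of_real cis.sel) simp
    qed
    ultimately show ?thesis by simp
  qed
  ultimately show ?thesis
    using g(2)[of \<theta>] by (simp add: sums_iff)
qed

text \<open>The Moebius map inside the logarithmic formula for \<open>Arctan\<close> sends the open
  right half of the unit circle to the negative imaginary axis, where \<open>Ln\<close> has constant
  imaginary part \<open>- pi / 2\<close>. The factor \<open>t\<close> is the distance of the image
  from 0.\<close>

lemma Re_Arctan_cis:
  assumes "\<bar>v\<bar> < pi / 2"
  shows "Re (Arctan (cis v)) = pi / 4"
proof -
  have c: "cos v > 0" using assms by (intro cos_gt_zero_pi) auto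
  then have s: "sin v < 1"
  proof -
    have "sin v \<noteq> 1" using c sin_cos_squared_add[of v] by (metis add_cancel_left_right less_irrefl one_power2 power_eq_0_iff)
    then show ?thesis using sin_le_one[of v] by linarith
  qed
  define t where "t = cos v / (1 - sin v)"
  have t: "t > 0" using c s by (simp add: t_def)
  have e: "1 - \<i> * cis v = of_real t * (- \<i>) * (1 + \<i> * cis v)"
    using s sin_cos_squared_add[of v]
    by (simp add: t_def complex_eq_iff field_simps power2_eq_square)
  have "1 + \<i> * cis v \<noteq> 0"
    using c by (simp add: complex_eq_iff)
  then have "(1 - \<i> * cis v) / (1 + \<i> * cis v) = of_real t * (- \<i>)"
    using e by simp
  then have "Arctan (cis v) = (\<i> / 2) * (of_real (ln t) + Ln (- \<i>))"
    unfolding Arctan_def using Ln_times_of_real[of t "- \<i>"] t by (simp only:) (simp add: Ln_of_real)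
  then have "Re (Arctan (cis v)) = Re ((\<i> / 2) * (of_real (ln t) + Ln (- \<i>)))"
    by (rule arg_cong)
  then show ?thesis by simp
qed

text \<open>For \<open>r < 1\<close> the fundamental theorem of calculus expresses the Abel mean as
  the integral \<open>H r\<close> of its derivative. Both sides are continuous in \<open>r\<close>
  up to 1, where the integrand becomes the constant \<open>pi / 4\<close>.\<close>

lemma abel_triangle_1:
  assumes "0 \<le> \<theta>" "\<theta> \<le> pi / 2"
  shows "abel_triangle 1 \<theta> = pi / 4 * \<theta>"
proof -
  have *: "abel_triangle 1 \<theta> = pi / 4 * \<theta>" if \<theta>: "0 \<le> \<theta>" "\<theta> < pi / 2" for \<theta>
  proof -
    define H where "H r = integral {0..\<theta>} (\<lambda>v. Re (Arctan (of_real r * cis v)))" for r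
    have "continuous_on ({0..1} \<times> cbox 0 \<theta>) (\<lambda>(r, v). Re (Arctan (complex_of_real r * cis v)))"
      unfolding split_def
    proof (intro continuous_on_Re continuous_on_compose2[OF continuous_on_Arctan[of "{z. Re z = 0 \<longrightarrow> \<bar>Im z\<bar> < 1}"]])
      show "continuous_on ({0..1} \<times> cbox 0 \<theta>) (\<lambda>x. complex_of_real (fst x) * cis (snd x))"
        by (intro continuous_intros)
      show "(\<lambda>x. complex_of_real (fst x) * cis (snd x)) ` ({0..1} \<times> cbox 0 \<theta>) \<subseteq> {z. Re z = 0 \<longrightarrow> \<bar>Im z\<bar> < 1}"
      proof clarsimp
        fix r v :: real assume "0 \<le> v" "v \<le> \<theta>" "r = 0 \<or> cos v = 0"
        moreover have "cos v > 0"
          using \<theta> \<open>0 \<le> v\<close> \<open>v \<le> \<theta>\<close> by (intro cos_gt_zero_pi) auto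
        ultimately show "\<bar>r * sin v\<bar> < 1" by simp
      qed
    qed auto
    then have "continuous_on {0..1} H"
      unfolding H_def cbox_interval[symmetric] by (rule integral_continuous_on_param)
    then have "continuous_on {0..1} (\<lambda>r. abel_triangle r \<theta> - H r)"
      by (intro continuous_on_diff continuous_on_abel_triangle)
    moreover have "abel_triangle r \<theta> - H r = 0" if "r \<in> {0..<1}" for r
    proof -
      have "((\<lambda>v. Re (Arctan (of_real r * cis v))) has_integral abel_triangle r \<theta> - abel_triangle r 0) {0..\<theta>}"
        using \<theta> that DERIV_abel_triangle[of r]
        by (intro fundamental_theorem_of_calculus)
          (auto simp: has_real_derivative_iff_has_vector_derivative intro: has_vector_derivative_at_within)
      moreover have "abel_triangle r 0 = 0" by (simp add: abel_triangle_def)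
      ultimately show ?thesis by (simp add: H_def integral_unique)
    qed
    ultimately have "abel_triangle 1 \<theta> - H 1 = 0"
      using continuous_constant_on_closure[of "{0..<1}" "\<lambda>r. abel_triangle r \<theta> - H r" 0 1] by simp
    moreover have "H 1 = integral {0..\<theta>} (\<lambda>v. pi / 4)"
      unfolding H_def using \<theta> by (intro integral_cong) (auto simp: Re_Arctan_cis)
    ultimately show ?thesis using \<theta> by (simp add: mult.commute)
  qed
  \<comment> \<open>At \<open>pi / 2\<close> the argument \<open>cis (pi / 2) = \<i>\<close> is a
    singularity of \<open>Arctan\<close>, so this end point is reached by continuity in
    \<open>\<theta>\<close>.\<close>
  have cont: "continuous_on UNIV (\<lambda>\<theta>. abel_triangle 1 \<theta> - pi / 4 * \<theta>)"
    by (rule continuous_on_diff[OF continuous_on_abel_triangle_1]) (intro continuous_intros)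
  have zero: "abel_triangle 1 x - pi / 4 * x = 0" if "x \<in> {0..<pi/2}" for x
    using *[of x] that by simp
  have "\<theta> \<in> closure {0..<pi/2}"
    using assms pi_gt_zero by simp
  from continuous_constant_on_closure[OF continuous_on_subset[OF cont subset_UNIV] zero this]
  show ?thesis by simp
qed

lemma triangle_wave_sums:
  assumes "\<bar>\<theta>\<bar> \<le> pi / 2"
  shows "(\<lambda>n. (-1) ^ n / (real (2 * n + 1))\<^sup>2 * sin (real (2 * n + 1) * \<theta>)) sums (pi / 4 * \<theta>)"
proof -
  have pos: "(\<lambda>n. (-1) ^ n / (real (2 * n + 1))\<^sup>2 * sin (real (2 * n + 1) * \<theta>)) sums (pi / 4 * \<theta>)"
    if "0 \<le> \<theta>" "\<theta> \<le> pi / 2" for \<theta>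
    using summable_sums[OF summable_abel_triangle[of 1 \<theta>]]
    unfolding abel_triangle_1[OF that, symmetric] by (simp add: abel_triangle_def)
  show ?thesis
  proof (cases "\<theta> \<ge> 0")
    case False
    with sums_minus[OF pos[of "-\<theta>"]] assms show ?thesis by simp
  qed (use pos assms in auto)
qed

text \<open>The triangle wave at its peak \<open>pi / 2\<close>, where each sine cancels the
  alternating sign.\<close>

lemma inverse_odd_squares_sums: "(\<lambda>n. 1 / (real (2 * n + 1))\<^sup>2) sums (pi\<^sup>2 / 8)"
proof -
  have "sin (real (2 * n + 1) * (pi / 2)) = (-1) ^ n" for n
  proof -
    have "sin (real (2 * n + 1) * (pi / 2)) = sin (pi / 2 + real n * pi)"
      by (simp add: field_simps)
    then show ?thesis by (simp add: sin_add)
  qed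
  with triangle_wave_sums[of "pi / 2"] show ?thesis
    by (simp add: power2_eq_square flip: power_mult_distrib)
qed

section \<open>Riesz interpolation formula\<close>

text \<open>Normalized so that the weights of the two symmetric nodes, summed over all
  \<open>n\<close>, have total 1.\<close>

definition riesz_weight :: "nat \<Rightarrow> real" where
  "riesz_weight n = 4 / (pi\<^sup>2 * (real (2 * n + 1))\<^sup>2)"

text \<open>The frequencies of the triangle wave of period \<open>4 * s\<close>. As multipliers on
  the Fourier side, they turn into translations of the function.\<close>

definition riesz_node :: "real \<Rightarrow> nat \<Rightarrow> real" where
  "riesz_node s n = real (2 * n + 1) * pi / (2 * s)"

lemma riesz_weight_nonneg: "riesz_weight n \<ge> 0"
  by (simp add: riesz_weight_def)

lemma riesz_weight_sums: "riesz_weight sums (1 / 2)"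
  using sums_mult[OF inverse_odd_squares_sums, of "4 / pi\<^sup>2"]
  by (simp add: riesz_weight_def[abs_def])

lemma riesz_multiplier_sums:
  assumes "s > 0" "\<bar>\<xi>\<bar> \<le> s"
  shows "(\<lambda>n. 2 * s * riesz_weight n * (-1) ^ n * sin (riesz_node s n * \<xi>)) sums \<xi>"
proof -
  have "\<bar>pi * \<xi> / (2 * s)\<bar> \<le> pi / 2"
    using assms by (simp add: abs_mult field_simps)
  \<comment> \<open>The factor \<open>8 * s / pi\<^sup>2\<close> inverts the product of
    \<open>pi / 4\<close> and the rescaling \<open>pi / (2 * s)\<close>.\<close>
  from sums_mult[OF triangle_wave_sums[OF this], of "8 * s / pi\<^sup>2"]
  have "(\<lambda>n. 8 * s / pi\<^sup>2 * ((-1) ^ n / (real (2 * n + 1))\<^sup>2 * sin (real (2 * n + 1) * (pi * \<xi> / (2 * s))))) sums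
      (8 * s / pi\<^sup>2 * (pi / 4 * (pi * \<xi> / (2 * s))))" .
  moreover have "8 * s / pi\<^sup>2 * (pi / 4 * (pi * \<xi> / (2 * s))) = \<xi>"
    using assms by (simp add: field_simps power2_eq_square)
  moreover have "8 * s / pi\<^sup>2 * ((-1) ^ n / (real (2 * n + 1))\<^sup>2 * sin (real (2 * n + 1) * (pi * \<xi> / (2 * s))))
      = 2 * s * riesz_weight n * (-1) ^ n * sin (riesz_node s n * \<xi>)" for n
    by (simp add: riesz_weight_def riesz_node_def mult.assoc del: of_nat_Suc of_nat_add of_nat_mult)
  ultimately show ?thesis by (simp del: of_nat_Suc of_nat_add of_nat_mult)
qed

lemma integral_lborel_compact_support:
  fixes \<psi> :: "real \<Rightarrow> complex"
  assumes "continuous_on UNIV \<psi>" "\<And>x. x \<notin> {a..b} \<Longrightarrow> \<psi> x = 0"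
  shows "integral\<^sup>L lborel \<psi> = integral {a..b} \<psi>"
proof -
  have "set_integrable lborel {a..b} \<psi>"
    unfolding set_integrable_def using assms(1)
    by (intro borel_integrable_compact) (auto intro: continuous_on_subset)
  from set_borel_integral_eq_integral(2)[OF this]
  have "(LINT x|lborel. indicator {a..b} x *\<^sub>R \<psi> x) = integral {a..b} \<psi>"
    by (simp add: set_lebesgue_integral_def)
  moreover have "(\<lambda>x. indicator {a..b} x *\<^sub>R \<psi> x) = \<psi>"
  proof
    fix x show "indicator {a..b} x *\<^sub>R \<psi> x = \<psi> x"
      by (cases "x \<in> {a..b}") (simp_all add: assms(2))
  qed
  ultimately show ?thesis by simp
qed

text \<open>Riesz' interpolation formula: on \<open>[-s, s]\<close> the multiplier \<open>\<i>\<xi>\<close> of the derivative agrees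
  with the \<open>4s\<close>-periodic triangle wave, whose Fourier series is absolutely convergent with sum of
  moduli \<open>s\<close>.\<close>
lemma riesz_interpolation:
  assumes u: "continuous_on UNIV u" "integrable lborel u"
    and s: "s > 0" and band: "\<And>\<xi>. \<bar>\<xi>\<bar> > s \<Longrightarrow> fourier u \<xi> = 0"
  obtains g where "continuous_on UNIV g" "\<And>y. (u has_vector_derivative g y) (at y)"
    "\<And>y. (\<lambda>n. of_real (s * riesz_weight n * (-1) ^ n) *
      (u (y + riesz_node s n) - u (y - riesz_node s n))) sums g y"
proof -
  define c where "c = complex_of_real (1 / sqrt (2 * pi))"
  define F where "F = fourier u"
  define E where "E y \<xi> = exp (\<i> * complex_of_real (y * \<xi>))" for y \<xi>
  define g where "g y = c * (LINT \<xi>|lborel. F \<xi> * (\<i> * of_real \<xi>) * E y \<xi>)" for y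
  have Fc: "continuous_on UNIV F"
    unfolding F_def by (rule continuous_fourier[OF u(2)])
  have F0: "F \<xi> = 0" if "\<xi> \<notin> {-s..s}" for \<xi>
    unfolding F_def using that by (intro band) auto
  have Fint: "integrable lborel F"
    using Fc F0 by (rule integrable_compact_support)
  have normE: "norm (E y \<xi>) = 1" for y \<xi>
    unfolding E_def by (rule norm_exp_i_times)
  have Ec: "continuous_on UNIV (E y)" for y
    unfolding E_def by (intro continuous_intros)
  have [measurable]: "F \<in> borel_measurable borel" "E y \<in> borel_measurable borel" for y
    using Fc Ec by (auto intro: borel_measurable_continuous_onI)
  have inv: "u y = c * (LINT \<xi>|lborel. F \<xi> * E y \<xi>)" for y
    using fourier_inversion[OF u, of y] Fc Fint by (simp add: F_def c_def E_def)
  \<comment> \<open>\<open>g\<close> is the Fourier transform of a compactly supported function,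
    read at \<open>- y\<close>.\<close>
  have gc: "continuous_on UNIV g"
  proof -
    have "integrable lborel (\<lambda>\<xi>. F \<xi> * (\<i> * of_real \<xi>))"
      by (rule integrable_compact_support[of _ "-s" s]) (intro continuous_intros Fc, simp add: F0)
    from continuous_on_compose2[OF continuous_fourier[OF this], of UNIV uminus]
    have "continuous_on UNIV (\<lambda>y. fourier (\<lambda>\<xi>. F \<xi> * (\<i> * of_real \<xi>)) (- y))"
      by (simp add: continuous_on_minus)
    moreover have "fourier (\<lambda>\<xi>. F \<xi> * (\<i> * of_real \<xi>)) (- y) = g y" for y
      unfolding fourier_def g_def c_def E_def by (simp add: mult_ac)
    ultimately show ?thesis by simp
  qed
  have deriv: "(u has_vector_derivative g y) (at y)" for y
  proof -
    have dE: "((\<lambda>y. F \<xi> * E y \<xi>) has_vector_derivative F \<xi> * (\<i> * of_real \<xi>) * E y \<xi>) (at y within UNIV)" for y \<xi>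
    proof -
      have "((\<lambda>z. F \<xi> * exp (\<i> * (z * complex_of_real \<xi>))) has_field_derivative
          F \<xi> * (\<i> * of_real \<xi>) * E y \<xi>) (at (complex_of_real y))"
        unfolding E_def by (auto intro!: derivative_eq_intros)
      from has_vector_derivative_real_field[OF this] show ?thesis
        by (simp add: E_def)
    qed
    have "((\<lambda>y. integral (cbox (-s) s) (\<lambda>\<xi>. F \<xi> * E y \<xi>)) has_vector_derivative
        integral (cbox (-s) s) (\<lambda>\<xi>. F \<xi> * (\<i> * of_real \<xi>) * E y \<xi>)) (at y within UNIV)"
    proof (rule leibniz_rule_vector_derivative[OF dE])
      show "(\<lambda>\<xi>. F \<xi> * E x \<xi>) integrable_on cbox (-s) s" for x
        by (intro integrable_continuous continuous_on_mult continuous_on_subset[OF Fc] continuous_on_subset[OF Ec]) auto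
      have "continuous_on (UNIV \<times> cbox (-s) s) (\<lambda>x. F (snd x))"
        by (rule continuous_on_compose2[OF Fc]) (auto intro!: continuous_intros)
      then show "continuous_on (UNIV \<times> cbox (-s) s) (\<lambda>(x, t). F t * (\<i> * of_real t) * E x t)"
        unfolding split_def E_def by (intro continuous_intros)
    qed auto
    then have "((\<lambda>y. c * integral {-s..s} (\<lambda>\<xi>. F \<xi> * E y \<xi>)) has_vector_derivative
        c * integral {-s..s} (\<lambda>\<xi>. F \<xi> * (\<i> * of_real \<xi>) * E y \<xi>)) (at y)"
      unfolding cbox_interval by (rule has_vector_derivative_mult_right)
    moreover have "integral {-s..s} (\<lambda>\<xi>. F \<xi> * E y \<xi>) = (LINT \<xi>|lborel. F \<xi> * E y \<xi>)" for y
      by (rule integral_lborel_compact_support[symmetric]) (intro continuous_on_mult Fc Ec, simp add: F0)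
    moreover have "integral {-s..s} (\<lambda>\<xi>. F \<xi> * (\<i> * of_real \<xi>) * E y \<xi>) = (LINT \<xi>|lborel. F \<xi> * (\<i> * of_real \<xi>) * E y \<xi>)"
      by (rule integral_lborel_compact_support[symmetric])
        (rule continuous_on_mult[OF continuous_on_mult[OF Fc] Ec], intro continuous_intros, simp add: F0)
    ultimately have "((\<lambda>y. c * (LINT \<xi>|lborel. F \<xi> * E y \<xi>)) has_vector_derivative g y) (at y)"
      by (simp add: g_def)
    then show ?thesis
      by (simp flip: inv)
  qed
  have "(\<lambda>n. of_real (s * riesz_weight n * (-1) ^ n) *
      (u (y + riesz_node s n) - u (y - riesz_node s n))) sums g y" for y
  proof -
    define a where "a n \<xi> = 2 * s * riesz_weight n * (-1) ^ n * sin (riesz_node s n * \<xi>)" for n \<xi>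
    define f where "f n \<xi> = F \<xi> * E y \<xi> * (\<i> * of_real (a n \<xi>))" for n \<xi>
    have [measurable]: "a n \<in> borel_measurable borel" for n
      unfolding a_def by measurable
    have fm [measurable]: "f n \<in> borel_measurable borel" for n
      unfolding f_def by measurable
    have a_le: "\<bar>a n \<xi>\<bar> \<le> 2 * s * riesz_weight n" for n \<xi>
      using s riesz_weight_nonneg[of n] abs_sin_le_one[of "riesz_node s n * \<xi>"]
      by (simp add: a_def abs_mult mult_left_le)
    have f_le: "norm (f n \<xi>) \<le> norm (F \<xi>) * (2 * s * riesz_weight n)" for n \<xi>
      unfolding f_def norm_mult normE using a_le[of n \<xi>]
      by (simp add: mult_left_mono)
    have sw: "summable (\<lambda>n. C * (2 * s * riesz_weight n))" for C
      using riesz_weight_sums by (intro summable_mult) (simp add: sums_iff)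
    have fint: "integrable lborel (f n)" for n
      by (rule Bochner_Integration.integrable_bound[of _ "\<lambda>\<xi>. norm (F \<xi>) * (2 * s * riesz_weight n)"])
        (use Fint fm f_le riesz_weight_nonneg s in \<open>auto simp: abs_mult\<close>)
    have "(\<lambda>n. integral\<^sup>L lborel (f n)) sums (LINT \<xi>|lborel. (\<Sum>n. f n \<xi>))"
    proof (rule sums_integral[OF fint])
      show "AE \<xi> in lborel. summable (\<lambda>n. norm (f n \<xi>))"
        by (intro AE_I2 summable_comparison_test'[OF sw]) (use f_le in auto)
      have "norm (LINT \<xi>|lborel. norm (f n \<xi>)) \<le> (LINT \<xi>|lborel. norm (F \<xi>)) * (2 * s * riesz_weight n)" for n
      proof -
        have "(LINT \<xi>|lborel. norm (f n \<xi>)) \<le> (LINT \<xi>|lborel. norm (F \<xi>) * (2 * s * riesz_weight n))"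
          using fint Fint f_le by (intro integral_mono) auto
        then show ?thesis by simp
      qed
      then show "summable (\<lambda>n. LINT \<xi>|lborel. norm (f n \<xi>))"
        by (intro summable_comparison_test'[OF sw])
    qed
    \<comment> \<open>Outside \<open>{-s..s}\<close> the triangle wave departs from \<xi>, but there
      \<open>F\<close> vanishes.\<close>
    moreover have "(\<Sum>n. f n \<xi>) = F \<xi> * (\<i> * of_real \<xi>) * E y \<xi>" for \<xi>
    proof (cases "\<xi> \<in> {-s..s}")
      case True
      then have "(\<lambda>n. a n \<xi>) sums \<xi>"
        unfolding a_def using s by (intro riesz_multiplier_sums) auto
      then have "(\<lambda>n. f n \<xi>) sums (F \<xi> * E y \<xi> * (\<i> * of_real \<xi>))"
        unfolding f_def by (intro sums_mult sums_of_real)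
      then show ?thesis by (simp add: sums_iff mult_ac)
    qed (simp add: f_def F0)
    ultimately have "(\<lambda>n. c * integral\<^sup>L lborel (f n)) sums g y"
      unfolding g_def by (intro sums_mult) simp
    moreover have "c * integral\<^sup>L lborel (f n) = of_real (s * riesz_weight n * (-1) ^ n) *
      (u (y + riesz_node s n) - u (y - riesz_node s n))" for n
    proof -
      define t where "t = riesz_node s n"
      have FE: "integrable lborel (\<lambda>\<xi>. F \<xi> * E z \<xi>)" for z
        by (rule integrable_compact_support[of _ "-s" s]) (intro continuous_on_mult Fc Ec, simp add: F0)
      \<comment> \<open>Euler's formula splits the sine into two characters, each of which shifts
        \<open>y\<close> by \<open>t\<close> in one direction.\<close>
      have "f n \<xi> = of_real (s * riesz_weight n * (-1) ^ n) * (F \<xi> * E (y + t) \<xi> - F \<xi> * E (y - t) \<xi>)" for \<xi>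
      proof -
        have e: "exp (\<i> * complex_of_real (t * \<xi>)) - exp (- (\<i> * complex_of_real (t * \<xi>))) = 2 * \<i> * of_real (sin (t * \<xi>))"
          by (simp add: sin_of_real[symmetric] sin_exp_eq)
        have "E (y + t) \<xi> = E y \<xi> * exp (\<i> * complex_of_real (t * \<xi>))"
          "E (y - t) \<xi> = E y \<xi> * exp (- (\<i> * complex_of_real (t * \<xi>)))"
          unfolding E_def exp_add[symmetric] by (simp_all add: algebra_simps)
        then have "F \<xi> * E (y + t) \<xi> - F \<xi> * E (y - t) \<xi> = F \<xi> * E y \<xi> * (2 * \<i> * of_real (sin (t * \<xi>)))"
          unfolding e[symmetric] by (simp add: algebra_simps)
        then show ?thesis
          by (simp add: f_def a_def t_def mult_ac)
      qed
      then have "f n = (\<lambda>\<xi>. of_real (s * riesz_weight n * (-1) ^ n) * (F \<xi> * E (y + t) \<xi> - F \<xi> * E (y - t) \<xi>))"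
        by (rule ext)
      then have "integral\<^sup>L lborel (f n) = of_real (s * riesz_weight n * (-1) ^ n) *
          ((LINT \<xi>|lborel. F \<xi> * E (y + t) \<xi>) - (LINT \<xi>|lborel. F \<xi> * E (y - t) \<xi>))"
        by (simp only: integral_mult_right_zero Bochner_Integration.integral_diff[OF FE FE])
      then show ?thesis
        unfolding inv[of "y + riesz_node s n"] inv[of "y - riesz_node s n"] t_def
        by (simp only: right_diff_distrib mult_ac)
    qed
    ultimately show ?thesis by simp
  qed
  with gc deriv show thesis by (rule that)
qed

text \<open>The convex function \<open>t powr r\<close> lies above its tangent at \<open>S\<close>.
  In this form Jensen's inequality is affine in \<open>t\<close>, so it passes directly through the
  infinite sum and the integral of the averaging.\<close>

lemma Young_tangent:
  fixes r :: real
  assumes "r \<ge> 1" "S \<ge> 0" "t \<ge> 0"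
  shows "r * S powr (r - 1) * t \<le> t powr r + (r - 1) * S powr r"
proof (cases "S = 0 \<or> t = 0")
  case False
  then have "(t powr r) powr (1 / r) * (S powr r) powr (1 - 1 / r) \<le> (1 / r) * t powr r + (1 - 1 / r) * S powr r"
    using assms by (intro Youngs_inequality_0) auto
  moreover have "(S powr r) powr (1 - 1 / r) = S powr (r - 1)" "(t powr r) powr (1 / r) = t"
    using assms False by (simp_all add: powr_powr right_diff_distrib)
  ultimately have "r * (t * S powr (r - 1)) \<le> r * ((1 / r) * t powr r + (1 - 1 / r) * S powr r)"
    using assms by (intro mult_left_mono) auto
  also have "\<dots> = t powr r + (r - 1) * S powr r"
    using assms by (simp add: algebra_simps)
  finally show ?thesis by (simp add: mult_ac)
qed (use assms in auto)

section \<open>Sampling of integrable band-limited functions\<close>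

lemma nn_integral_translate:
  fixes v :: "real \<Rightarrow> ennreal"
  assumes "v \<in> borel_measurable borel"
  shows "(\<integral>\<^sup>+ x. v (x + t) \<partial>lborel) = (\<integral>\<^sup>+ x. v x \<partial>lborel)"
  using nn_integral_real_affine[OF assms, of 1 t] by (simp add: add.commute)

lemma nn_integral_continuous_Icc:
  fixes \<phi> :: "real \<Rightarrow> real"
  assumes "continuous_on UNIV \<phi>" "\<And>x. \<phi> x \<ge> 0"
  shows "(\<integral>\<^sup>+ x. ennreal (\<phi> x) * indicator {a..b} x \<partial>lborel) = ennreal (integral {a..b} \<phi>)"
proof -
  have int: "set_integrable lborel {a..b} \<phi>"
    unfolding set_integrable_def using assms(1)
    by (intro borel_integrable_compact) (auto intro: continuous_on_subset)
  have "(\<integral>\<^sup>+ x. ennreal (\<phi> x) * indicator {a..b} x \<partial>lborel) =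
      (\<integral>\<^sup>+ x. ennreal (indicator {a..b} x *\<^sub>R \<phi> x) \<partial>lborel)"
    by (intro nn_integral_cong) (auto simp: indicator_def)
  also have "\<dots> = ennreal (LINT x|lborel. indicator {a..b} x *\<^sub>R \<phi> x)"
    using int assms(2) unfolding set_integrable_def by (intro nn_integral_eq_integral) auto
  also have "(LINT x|lborel. indicator {a..b} x *\<^sub>R \<phi> x) = integral {a..b} \<phi>"
    using set_borel_integral_eq_integral(2)[OF int] by (simp add: set_lebesgue_integral_def)
  finally show ?thesis .
qed

text \<open>With \<open>v = \<bar>u\<bar>\<close> this dominates \<open>\<bar>u\<bar> + h\<bar>u'\<bar>\<close>, while its total mass is only
  \<open>1 + hs\<close> times that of \<open>v\<close>.\<close>
definition riesz_majorant :: "real \<Rightarrow> real \<Rightarrow> (real \<Rightarrow> ennreal) \<Rightarrow> real \<Rightarrow> ennreal" where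
  "riesz_majorant h s v z = v z + ennreal (h * s) *
     (\<Sum>n. ennreal (riesz_weight n) * (v (z + riesz_node s n) + v (z - riesz_node s n)))"

lemma suminf_riesz_weight: "(\<Sum>n. ennreal (riesz_weight n)) = ennreal (1 / 2)"
  by (rule suminf_ennreal_eq[OF riesz_weight_nonneg riesz_weight_sums])

lemma ennreal_half_double: "ennreal (1 / 2) * (c + c) = c"
proof -
  have "ennreal (1 / 2) * (c + c) = (ennreal (1 / 2) * 2) * c"
    by (simp add: mult_2 mult.assoc)
  also have "ennreal (1 / 2) * 2 = 1"
    by (metis ennreal_numeral ennreal_mult'' ennreal_1 nonzero_mult_div_cancel_right times_divide_eq_left
        zero_le_numeral zero_neq_numeral mult_1)
  finally show ?thesis by simp
qed

lemma measurable_riesz_majorant [measurable]: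
  assumes [measurable]: "v \<in> borel_measurable borel"
  shows "riesz_majorant h s v \<in> borel_measurable borel"
  unfolding riesz_majorant_def by measurable

text \<open>Every translate has the mass of \<open>v\<close>, and the node weights add up to
  1.\<close>

lemma nn_integral_riesz_majorant:
  assumes [measurable]: "v \<in> borel_measurable borel" and "h \<ge> 0" "s \<ge> 0"
  shows "(\<integral>\<^sup>+ z. riesz_majorant h s v z \<partial>lborel) = ennreal (1 + h * s) * (\<integral>\<^sup>+ z. v z \<partial>lborel)"
proof -
  define I where "I = (\<integral>\<^sup>+ z. v z \<partial>lborel)"
  have t: "(\<integral>\<^sup>+ z. v (z + t) \<partial>lborel) = I" "(\<integral>\<^sup>+ z. v (z - t) \<partial>lborel) = I" for t
    using nn_integral_translate[of v t] nn_integral_translate[of v "- t"] by (simp_all add: I_def)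
  have "(\<integral>\<^sup>+ z. riesz_majorant h s v z \<partial>lborel) = I + ennreal (h * s) *
     (\<Sum>n. ennreal (riesz_weight n) * (I + I))"
    unfolding riesz_majorant_def
    by (simp add: nn_integral_add nn_integral_cmult nn_integral_suminf t del: ennreal_suminf_cmult)
      (simp add: I_def)
  also have "(\<Sum>n. ennreal (riesz_weight n) * (I + I)) = I"
    unfolding ennreal_suminf_multc suminf_riesz_weight by (rule ennreal_half_double)
  also have "I + ennreal (h * s) * I = ennreal (1 + h * s) * I"
    using assms(2,3) by (simp add: ennreal_plus distrib_right)
  finally show ?thesis by (simp add: I_def)
qed

text \<open>The majorant is linear and monotone with total weight \<open>1 + h * s\<close>, which is
  therefore the factor collected by the constant \<open>d\<close>. This carries the tangent
  inequality under the average.\<close>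

lemma riesz_majorant_affine_le:
  assumes "\<And>z. c * v z \<le> w z + d" "h \<ge> 0" "s \<ge> 0"
  shows "c * riesz_majorant h s v z \<le> riesz_majorant h s w z + ennreal (1 + h * s) * d"
proof -
  define t where "t = riesz_node s"
  have "c * riesz_majorant h s v z = c * v z + ennreal (h * s) *
     (\<Sum>n. ennreal (riesz_weight n) * (c * v (z + t n) + c * v (z - t n)))"
    unfolding riesz_majorant_def t_def
    by (simp add: distrib_left ennreal_suminf_cmult[symmetric] mult_ac del: ennreal_suminf_cmult)
  also have "\<dots> \<le> (w z + d) + ennreal (h * s) *
     (\<Sum>n. ennreal (riesz_weight n) * ((w (z + t n) + d) + (w (z - t n) + d)))"
    by (intro add_mono mult_left_mono suminf_le assms(1)) auto
  also have "(\<Sum>n. ennreal (riesz_weight n) * ((w (z + t n) + d) + (w (z - t n) + d))) =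
      (\<Sum>n. ennreal (riesz_weight n) * (w (z + t n) + w (z - t n)) + ennreal (riesz_weight n) * (d + d))"
    by (simp add: distrib_left add_ac)
  also have "\<dots> = (\<Sum>n. ennreal (riesz_weight n) * (w (z + t n) + w (z - t n))) + (\<Sum>n. ennreal (riesz_weight n) * (d + d))"
    by (rule suminf_add[symmetric]) auto
  also have "(\<Sum>n. ennreal (riesz_weight n) * (d + d)) = d"
    unfolding ennreal_suminf_multc suminf_riesz_weight by (rule ennreal_half_double)
  also have "(w z + d) + ennreal (h * s) * ((\<Sum>n. ennreal (riesz_weight n) * (w (z + t n) + w (z - t n))) + d)
      = riesz_majorant h s w z + ennreal (1 + h * s) * d"
    using assms(2,3) unfolding riesz_majorant_def t_def by (simp add: ennreal_plus distrib_left distrib_right add_ac)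
  finally show ?thesis .
qed

text \<open>The fundamental theorem of calculus bounds \<open>norm (u a)\<close> by
  \<open>norm (u y)\<close> plus the integral of \<open>norm (g z)\<close> over the cell, for every
  \<open>y\<close> in it. Integrating over \<open>y\<close> and estimating the derivative by the
  interpolation formula gives the majorant.\<close>

lemma riesz_majorant_ge:
  assumes u: "continuous_on UNIV u" "integrable lborel u"
    and s: "s > 0" and band: "\<And>\<xi>. \<bar>\<xi>\<bar> > s \<Longrightarrow> fourier u \<xi> = 0" and h: "h > 0"
  shows "ennreal h * ennreal (norm (u a)) \<le>
    (\<integral>\<^sup>+ z. riesz_majorant h s (\<lambda>z. ennreal (norm (u z))) z * indicator {a..<a + h} z \<partial>lborel)"
proof -
  obtain g where gc: "continuous_on UNIV g" and der: "\<And>y. (u has_vector_derivative g y) (at y)"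
    and gs: "\<And>y. (\<lambda>n. of_real (s * riesz_weight n * (-1) ^ n) *
      (u (y + riesz_node s n) - u (y - riesz_node s n))) sums g y"
    using riesz_interpolation[OF u s band] by blast
  define N where "N = integral {a..a + h} (\<lambda>z. norm (g z))"
  have cu: "continuous_on {x..y} (\<lambda>z. norm (u z))" "continuous_on {x..y} (\<lambda>z. norm (g z))" for x y
    using u(1) gc by (auto intro!: continuous_on_norm intro: continuous_on_subset)
  have ptw: "norm (u a) \<le> norm (u y) + N" if "y \<in> {a..a + h}" for y
  proof -
    have "(g has_integral (u y - u a)) {a..y}"
      using that by (intro fundamental_theorem_of_calculus) (auto intro: has_vector_derivative_at_within der)
    then have "norm (u y - u a) \<le> integral {a..y} (\<lambda>z. norm (g z))"
      using integral_norm_bound_integral[of g "{a..y}" "\<lambda>z. norm (g z)"]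
        integrable_continuous_interval[OF cu(2)]
      by (simp add: has_integral_integrable integral_unique)
    also have "\<dots> \<le> N"
      unfolding N_def using that
      by (intro integral_subset_le integrable_continuous_interval cu) auto
    finally show ?thesis
      using norm_triangle_ineq2[of "u a" "u y"] by (simp add: norm_minus_commute)
  qed
  \<comment> \<open>Integrating over \<open>y\<close> multiplies the constant \<open>N\<close> by
    the cell length: this is the origin of the factor \<open>h\<close> in front of the
    derivative.\<close>
  have "h * norm (u a) = integral {a..a + h} (\<lambda>y. norm (u a))"
    using h by simp
  also have "\<dots> \<le> integral {a..a + h} (\<lambda>y. norm (u y) + N)"
    by (intro integral_le ptw integrable_continuous_interval continuous_on_add continuous_on_const cu) auto
  also have "\<dots> = integral {a..a + h} (\<lambda>y. norm (u y)) + h * N"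
    using h by (subst Henstock_Kurzweil_Integration.integral_add)
      (auto intro: integrable_continuous_interval cu)
  also have "\<dots> = integral {a..a + h} (\<lambda>y. norm (u y) + h * norm (g y))"
    unfolding N_def by (subst Henstock_Kurzweil_Integration.integral_add)
      (auto intro!: integrable_continuous_interval cu continuous_intros)
  finally have "ennreal (h * norm (u a)) \<le> ennreal (integral {a..a + h} (\<lambda>y. norm (u y) + h * norm (g y)))"
    by (rule ennreal_leI)
  also have "\<dots> = (\<integral>\<^sup>+ z. ennreal (norm (u z) + h * norm (g z)) * indicator {a..a + h} z \<partial>lborel)"
    using h u(1) gc by (intro nn_integral_continuous_Icc[symmetric] continuous_intros) auto
  \<comment> \<open>The cell becomes half-open so that cells of neighbouring sampling points do not
    overlap.\<close>
  also have "\<dots> = (\<integral>\<^sup>+ z. ennreal (norm (u z) + h * norm (g z)) * indicator {a..<a + h} z \<partial>lborel)"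
  proof (rule nn_integral_cong_AE)
    show "AE z in lborel. ennreal (norm (u z) + h * norm (g z)) * indicator {a..a + h} z =
        ennreal (norm (u z) + h * norm (g z)) * indicator {a..<a + h} z"
      using AE_lborel_singleton[of "a + h"] by eventually_elim (auto simp: indicator_def)
  qed
  also have "\<dots> \<le> (\<integral>\<^sup>+ z. riesz_majorant h s (\<lambda>z. ennreal (norm (u z))) z * indicator {a..<a + h} z \<partial>lborel)"
  proof (intro nn_integral_mono mult_right_mono)
    fix y
    define t where "t = riesz_node s"
    have "ennreal (norm (g y)) \<le> ennreal s * (\<Sum>n. ennreal (riesz_weight n) * (ennreal (norm (u (y + t n))) + ennreal (norm (u (y - t n)))))"
    proof (rule Lim_bounded)
      show "(\<lambda>N. ennreal (norm (\<Sum>n<N. of_real (s * riesz_weight n * (-1) ^ n) * (u (y + t n) - u (y - t n))))) \<longlonglongrightarrow> ennreal (norm (g y))"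
        using gs[of y] unfolding sums_def t_def by (intro tendsto_ennrealI tendsto_norm)
      show "\<forall>N\<ge>0. ennreal (norm (\<Sum>n<N. of_real (s * riesz_weight n * (-1) ^ n) * (u (y + t n) - u (y - t n))))
        \<le> ennreal s * (\<Sum>n. ennreal (riesz_weight n) * (ennreal (norm (u (y + t n))) + ennreal (norm (u (y - t n)))))"
      proof (intro allI impI)
        fix N :: nat
        have "norm (\<Sum>n<N. of_real (s * riesz_weight n * (-1) ^ n) * (u (y + t n) - u (y - t n)))
          \<le> (\<Sum>n<N. s * (riesz_weight n * (norm (u (y + t n)) + norm (u (y - t n)))))"
        proof (rule sum_norm_le)
          fix n
          have "norm (of_real (s * riesz_weight n * (-1) ^ n) * (u (y + t n) - u (y - t n))) =
             s * riesz_weight n * norm (u (y + t n) - u (y - t n))"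
            using s riesz_weight_nonneg[of n] by (simp add: norm_mult norm_power)
          also have "\<dots> \<le> s * riesz_weight n * (norm (u (y + t n)) + norm (u (y - t n)))"
            using s riesz_weight_nonneg[of n] by (intro mult_left_mono norm_triangle_ineq4) auto
          finally show "norm (of_real (s * riesz_weight n * (-1) ^ n) * (u (y + t n) - u (y - t n)))
            \<le> s * (riesz_weight n * (norm (u (y + t n)) + norm (u (y - t n))))"
            by (simp add: mult.assoc)
        qed
        then have "ennreal (norm (\<Sum>n<N. of_real (s * riesz_weight n * (-1) ^ n) * (u (y + t n) - u (y - t n))))
          \<le> ennreal (\<Sum>n<N. s * (riesz_weight n * (norm (u (y + t n)) + norm (u (y - t n)))))"
          by (rule ennreal_leI)
        also have "\<dots> = (\<Sum>n<N. ennreal s * (ennreal (riesz_weight n) * (ennreal (norm (u (y + t n))) + ennreal (norm (u (y - t n))))))"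
          using s riesz_weight_nonneg by (subst sum_ennreal[symmetric]) (auto simp: ennreal_mult ennreal_plus)
        also have "\<dots> \<le> (\<Sum>n. ennreal s * (ennreal (riesz_weight n) * (ennreal (norm (u (y + t n))) + ennreal (norm (u (y - t n))))))"
          by (rule sum_le_suminf) auto
        finally show "ennreal (norm (\<Sum>n<N. of_real (s * riesz_weight n * (-1) ^ n) * (u (y + t n) - u (y - t n))))
          \<le> ennreal s * (\<Sum>n. ennreal (riesz_weight n) * (ennreal (norm (u (y + t n))) + ennreal (norm (u (y - t n)))))"
          by simp
      qed
    qed
    then have "ennreal h * ennreal (norm (g y)) \<le> ennreal h * (ennreal s * (\<Sum>n. ennreal (riesz_weight n) * (ennreal (norm (u (y + t n))) + ennreal (norm (u (y - t n))))))"
      by (rule mult_left_mono) simp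
    then show "ennreal (norm (u y) + h * norm (g y)) \<le> riesz_majorant h s (\<lambda>z. ennreal (norm (u z))) y"
      using h s by (simp add: riesz_majorant_def t_def ennreal_plus ennreal_mult mult.assoc)
  qed simp
  finally show ?thesis
    using h by (simp add: ennreal_mult)
qed

text \<open>Jensen's inequality on each cell costs \<open>B powr (r - 1)\<close>, and the mass of
  the majorant costs another factor \<open>B\<close>. Finite index sets allow a termwise limit when
  the window is removed.\<close>

lemma band_limited_sampling:
  assumes u: "continuous_on UNIV u" "integrable lborel u"
    and s: "s > 0" and band: "\<And>\<xi>. \<bar>\<xi>\<bar> > s \<Longrightarrow> fourier u \<xi> = 0" and h: "h > 0"
    and r: "r \<ge> 1" and K: "finite K"
  shows "(\<Sum>k\<in>K. ennreal (h * norm (u (x - of_int k * h)) powr r)) \<le>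
    ennreal ((1 + h * s) powr r) * (\<integral>\<^sup>+ z. ennreal (norm (u z) powr r) \<partial>lborel)"
proof -
  define B where "B = 1 + h * s"
  have B: "B > 0" using s h by (simp add: B_def add_pos_pos)
  define w where "w z = ennreal (norm (u z) powr r)" for z
  define W where "W = riesz_majorant h s w"
  have [measurable]: "u \<in> borel_measurable borel"
    using u(1) by (rule borel_measurable_continuous_onI)
  have wm [measurable]: "w \<in> borel_measurable borel"
    unfolding w_def by measurable
  have Wm [measurable]: "W \<in> borel_measurable borel"
    unfolding W_def by measurable
  have one: "ennreal (h * norm (u a) powr r) \<le>
      ennreal (B powr (r - 1)) * (\<integral>\<^sup>+ z. W z * indicator {a..<a + h} z \<partial>lborel)" for a
  proof -
    \<comment> \<open>The averaging has total weight \<open>B\<close>, so the normalized mean of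
      \<open>norm (u z)\<close> is at least \<open>S\<close>; the tangent is taken at this
      value.\<close>
    define S where "S = norm (u a) / B"
    have S: "S \<ge> 0" and uS: "norm (u a) = S * B" using B by (simp_all add: S_def)
    define X where "X = (\<integral>\<^sup>+ z. W z * indicator {a..<a + h} z \<partial>lborel)"
    define c where "c = r * S powr (r - 1)"
    define d where "d = (r - 1) * S powr r"
    have c: "c \<ge> 0" and d: "d \<ge> 0" using r by (simp_all add: c_def d_def)
    have "ennreal c * ennreal (norm (u z)) \<le> w z + ennreal d" for z
      using Young_tangent[OF r S, of "norm (u z)"] c d
      by (simp add: w_def c_def d_def ennreal_mult[symmetric] ennreal_plus[symmetric] ennreal_leI del: ennreal_plus)
    from riesz_majorant_affine_le[of "ennreal c" "\<lambda>z. ennreal (norm (u z))" w "ennreal d" h s, OF this]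
    have maj: "ennreal c * riesz_majorant h s (\<lambda>z. ennreal (norm (u z))) z \<le> W z + ennreal B * ennreal d" for z
      using h s by (simp add: W_def B_def)
    have "ennreal c * (ennreal h * ennreal (norm (u a))) \<le> ennreal c *
        (\<integral>\<^sup>+ z. riesz_majorant h s (\<lambda>z. ennreal (norm (u z))) z * indicator {a..<a + h} z \<partial>lborel)"
      by (intro mult_left_mono riesz_majorant_ge[OF u s band h]) auto
    also have "\<dots> = (\<integral>\<^sup>+ z. (ennreal c * riesz_majorant h s (\<lambda>z. ennreal (norm (u z))) z) * indicator {a..<a + h} z \<partial>lborel)"
      by (subst nn_integral_cmult[symmetric]) (auto simp: mult.assoc)
    also have "\<dots> \<le> (\<integral>\<^sup>+ z. (W z + ennreal B * ennreal d) * indicator {a..<a + h} z \<partial>lborel)"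
      by (intro nn_integral_mono mult_right_mono maj) auto
    also have "\<dots> = X + ennreal B * ennreal d * ennreal h"
      using h by (simp add: X_def distrib_right nn_integral_add nn_integral_cmult)
    finally have le: "ennreal (c * (h * (S * B))) \<le> X + ennreal (B * d * h)"
      using B c d h S by (simp add: uS ennreal_mult)
    have cS: "c * S = r * S powr r"
      using powr_mult_base[OF S, of "r - 1"] by (simp add: c_def mult_ac)
    \<comment> \<open>In \<open>le\<close> the quantity \<open>S powr r * B * h\<close> occurs
      \<open>r\<close> times on the left and \<open>r - 1\<close> times on the right, so one copy
      survives. Subtraction requires \<open>X\<close> to be finite; otherwise the claim is
      trivial.\<close>
    have "ennreal (S powr r * B * h) \<le> X"
    proof (cases X)
      case (real q)
      have "c * (h * (S * B)) \<le> q + B * d * h"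
        using le real B d h by (simp add: ennreal_plus[symmetric] ennreal_le_iff del: ennreal_plus)
      moreover have "c * (h * (S * B)) = r * (S powr r * B * h)"
        using cS by (metis mult.assoc mult.commute)
      moreover have "B * d * h = r * (S powr r * B * h) - S powr r * B * h"
        by (simp add: d_def algebra_simps)
      ultimately have "S powr r * B * h \<le> q" by linarith
      then show ?thesis
        using real by (simp add: ennreal_leI)
    qed simp
    then have "ennreal (B powr (r - 1)) * ennreal (S powr r * B * h) \<le> ennreal (B powr (r - 1)) * X"
      by (rule mult_left_mono) simp
    moreover have "B powr (r - 1) * (S powr r * B * h) = h * norm (u a) powr r"
    proof -
      have "B powr (r - 1) * B = B powr r"
        using B powr_mult_base[of B "r - 1"] by (simp add: mult.commute)
      moreover have "norm (u a) powr r = S powr r * B powr r"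
        unfolding uS using S B by (simp add: powr_mult)
      ultimately show ?thesis by (metis mult.assoc mult.commute)
    qed
    ultimately show ?thesis
      using B S h by (simp add: X_def ennreal_mult[symmetric])
  qed
  define J where "J k = {x - of_int k * h..<x - of_int k * h + h}" for k :: int
  \<comment> \<open>Left end points of distinct cells are at least \<open>h\<close> apart, so each
    point meets at most one cell.\<close>
  have disj: "(\<Sum>k\<in>K. indicator (J k) z) \<le> (1 :: ennreal)" for z
  proof -
    have "k = l" if "z \<in> J k" "z \<in> J l" for k l
    proof -
      have "\<bar>of_int k * h - of_int l * h\<bar> < h"
        using that by (auto simp: J_def)
      moreover have "\<bar>of_int k * h - of_int l * h\<bar> = \<bar>of_int (k - l)\<bar> * h"
        using h by (simp add: abs_mult flip: left_diff_distrib)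
      ultimately have "\<bar>of_int (k - l) :: real\<bar> < 1"
        using h by simp
      then show ?thesis by linarith
    qed
    then have "card {k \<in> K. z \<in> J k} \<le> 1"
      using K by (simp add: card_le_Suc0_iff_eq)
    moreover have "(\<Sum>k\<in>K. indicator (J k) z :: ennreal) = of_nat (card {k \<in> K. z \<in> J k})"
      using K by (simp add: indicator_def sum.If_cases Int_def)
    ultimately show ?thesis
      using of_nat_mono[of "card {k \<in> K. z \<in> J k}" 1] by simp
  qed
  have "(\<Sum>k\<in>K. ennreal (h * norm (u (x - of_int k * h)) powr r)) \<le>
      (\<Sum>k\<in>K. ennreal (B powr (r - 1)) * (\<integral>\<^sup>+ z. W z * indicator (J k) z \<partial>lborel))"
    unfolding J_def by (intro sum_mono one)
  also have "\<dots> = ennreal (B powr (r - 1)) * (\<integral>\<^sup>+ z. (\<Sum>k\<in>K. W z * indicator (J k) z) \<partial>lborel)"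
    by (subst nn_integral_sum) (auto simp: J_def sum_distrib_left)
  also have "\<dots> \<le> ennreal (B powr (r - 1)) * (\<integral>\<^sup>+ z. W z \<partial>lborel)"
  proof (intro mult_left_mono nn_integral_mono)
    show "(\<Sum>k\<in>K. W z * indicator (J k) z) \<le> W z" for z
      using mult_left_mono[OF disj[of z], of "W z"] by (simp add: sum_distrib_left)
  qed simp
  also have "(\<integral>\<^sup>+ z. W z \<partial>lborel) = ennreal B * (\<integral>\<^sup>+ z. w z \<partial>lborel)"
    unfolding W_def B_def using h s by (intro nn_integral_riesz_majorant wm) auto
  also have "ennreal (B powr (r - 1)) * (ennreal B * (\<integral>\<^sup>+ z. w z \<partial>lborel)) = ennreal (B powr r) * (\<integral>\<^sup>+ z. w z \<partial>lborel)"
  proof -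
    have "B powr (r - 1) * B = B powr r"
      using B powr_mult_base[of B "r - 1"] by (simp add: mult.commute)
    then show ?thesis
      using B by (simp add: mult.assoc[symmetric] ennreal_mult[symmetric])
  qed
  finally show ?thesis by (simp add: B_def w_def)
qed

section \<open>Removing integrability, and the lower bound\<close>

text \<open>The exceptional set is open and negligible, hence empty.\<close>

lemma continuous_le_if_AE_le:
  fixes \<phi> :: "real \<Rightarrow> real"
  assumes "continuous_on UNIV \<phi>" "AE x in lborel. ennreal (\<phi> x) \<le> c"
  shows "ennreal (\<phi> x) \<le> c"
proof (rule ccontr)
  assume x: "\<not> ennreal (\<phi> x) \<le> c"
  define S where "S = {x. c < ennreal (\<phi> x)}"
  have "open S"
    unfolding S_def using assms(1)
    by (intro open_Collect_less continuous_on_const continuous_on_ennreal)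
  moreover have "S \<in> null_sets lborel"
    using assms(2) \<open>open S\<close> AE_iff_null[of lborel "\<lambda>x. ennreal (\<phi> x) \<le> c"]
    by (simp add: S_def not_le)
  then have "negligible S"
    by (simp add: negligible_iff_null_sets null_sets_completionI)
  ultimately have "S = {}"
    using open_not_negligible by blast
  with x show False by (auto simp: S_def not_le)
qed

section \<open>The window and the spectrum of windowed functions\<close>

lemma test_function_bump: "test_function (\<lambda>x. of_real (bump x))"
  by (rule test_functionI[OF Ck_bump, of "-1" 1]) (auto intro!: bump_eq_0)

lemma integral_bump_pos: "(LINT x|lborel. bump x) > 0"
proof -
  have int: "integrable lborel bump"
    using integrable_Re[OF integrable_test_function[OF test_function_bump]] by simp
  have cont: "continuous_on UNIV bump"
  proof -
    have "continuous_on UNIV (\<lambda>x. Re (complex_of_real (bump x)))"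
      using test_function_bump unfolding test_function_def
      by (intro continuous_on_Re smooth_continuous_on) auto
    then show ?thesis by simp
  qed
  have "(LINT x|lborel. bump x) \<noteq> 0"
  proof
    assume "(LINT x|lborel. bump x) = 0"
    then have "AE x in lborel. bump x = 0"
      using integral_nonneg_eq_0_iff_AE[OF int] bump_nonneg by simp
    then have "AE x in lborel. ennreal (bump x) \<le> 0"
      by eventually_elim simp
    then have "ennreal (bump 0) \<le> 0"
      by (rule continuous_le_if_AE_le[OF cont])
    then show False using bump_pos[of 0] by simp
  qed
  moreover have "(LINT x|lborel. bump x) \<ge> 0"
    by (intro integral_nonneg_AE) (simp add: bump_nonneg)
  ultimately show ?thesis by linarith
qed

definition window :: "real \<Rightarrow> complex" where
  "window x = fourier (\<lambda>\<zeta>. of_real (bump \<zeta>)) x / fourier (\<lambda>\<zeta>. of_real (bump \<zeta>)) 0"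

lemma fourier_bump_0: "fourier (\<lambda>\<zeta>. of_real (bump \<zeta>)) 0 = of_real ((LINT x|lborel. bump x) / sqrt (2 * pi))"
  by (simp add: fourier_def)

lemma fourier_bump_0_nonzero: "fourier (\<lambda>\<zeta>. of_real (bump \<zeta>)) 0 \<noteq> 0"
  unfolding fourier_bump_0 using integral_bump_pos by simp

lemma window_0: "window 0 = 1"
  using fourier_bump_0_nonzero by (simp add: window_def)

text \<open>The transform of a nonnegative function attains its largest modulus at 0, so multiplying
  by the window never increases \<open>norm (f x)\<close>.\<close>

lemma norm_window_le: "norm (window x) \<le> 1"
proof -
  have "norm (fourier (\<lambda>\<zeta>. of_real (bump \<zeta>)) x) \<le> (LINT x|lborel. bump x) / sqrt (2 * pi)"
    using norm_fourier_le[OF integrable_test_function[OF test_function_bump], of x] bump_nonneg by simp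
  then show ?thesis
    unfolding window_def fourier_bump_0 norm_divide norm_of_real
    using integral_bump_pos by (simp add: field_simps)
qed

lemma continuous_window: "continuous_on UNIV window"
  unfolding window_def using fourier_bump_0_nonzero
  by (intro continuous_on_divide continuous_fourier integrable_test_function test_function_bump continuous_on_const) auto

lemma window_decay:
  obtains C where "\<And>x. norm (window x) \<le> C / (1 + x\<^sup>2)"
proof -
  obtain C where C: "\<And>\<xi>. norm (fourier (\<lambda>\<zeta>. of_real (bump \<zeta>)) \<xi>) \<le> C / (1 + \<xi>\<^sup>2)"
    using fourier_test_function_decay[OF test_function_bump] by blast
  have "norm (window x) \<le> (C / norm (fourier (\<lambda>\<zeta>. of_real (bump \<zeta>)) 0)) / (1 + x\<^sup>2)" for x
    using divide_right_mono[OF C[of x], of "norm (fourier (\<lambda>\<zeta>. of_real (bump \<zeta>)) 0)"]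
    by (simp add: window_def norm_divide divide_divide_eq_left mult.commute)
  then show thesis by (rule that)
qed

text \<open>Modulation and dilation on one side are translation and rescaling on the other. Thus the
  transform of the windowed function at \<xi> becomes a pairing of \<open>f\<close> with the
  transform of a bump centred at \<xi>, without any convolution of distributions.\<close>

lemma window_eq_fourier:
  assumes "\<epsilon> > 0"
  shows "window (\<epsilon> * x) * exp (- (\<i> * complex_of_real x * complex_of_real \<xi>)) =
    fourier (\<lambda>\<zeta>. of_real (bump ((\<zeta> - \<xi>) / \<epsilon>))) x / (of_real \<epsilon> * fourier (\<lambda>\<zeta>. of_real (bump \<zeta>)) 0)"
proof -
  have "(LINT \<zeta>|lborel. of_real (bump ((\<zeta> - \<xi>) / \<epsilon>)) * exp (- (\<i> * complex_of_real \<zeta> * complex_of_real x))) =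
    \<bar>\<epsilon>\<bar> *\<^sub>R (LINT \<zeta>|lborel. of_real (bump ((\<xi> + \<epsilon> * \<zeta> - \<xi>) / \<epsilon>)) * exp (- (\<i> * complex_of_real (\<xi> + \<epsilon> * \<zeta>) * complex_of_real x)))"
    using assms by (intro lborel_integral_real_affine) simp
  also have "\<dots> = \<epsilon> *\<^sub>R (LINT \<zeta>|lborel. exp (- (\<i> * complex_of_real x * complex_of_real \<xi>)) *
      (of_real (bump \<zeta>) * exp (- (\<i> * complex_of_real \<zeta> * complex_of_real (\<epsilon> * x)))))"
  proof -
    have "exp (- (\<i> * complex_of_real (\<xi> + \<epsilon> * \<zeta>) * complex_of_real x)) =
      exp (- (\<i> * complex_of_real x * complex_of_real \<xi>)) * exp (- (\<i> * complex_of_real \<zeta> * complex_of_real (\<epsilon> * x)))" for \<zeta>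
      unfolding exp_add[symmetric] by (rule arg_cong[of _ _ exp]) (simp add: algebra_simps)
    then show ?thesis
      using assms by (simp add: mult_ac)
  qed
  also have "\<dots> = of_real \<epsilon> * (exp (- (\<i> * complex_of_real x * complex_of_real \<xi>)) *
      (LINT \<zeta>|lborel. of_real (bump \<zeta>) * exp (- (\<i> * complex_of_real \<zeta> * complex_of_real (\<epsilon> * x)))))"
    by (simp only: integral_mult_right_zero scaleR_conv_of_real)
  finally have "fourier (\<lambda>\<zeta>. of_real (bump ((\<zeta> - \<xi>) / \<epsilon>))) x = of_real \<epsilon> *
      (exp (- (\<i> * complex_of_real x * complex_of_real \<xi>)) * fourier (\<lambda>\<zeta>. of_real (bump \<zeta>)) (\<epsilon> * x))"
    unfolding fourier_def by (simp only: mult_ac)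
  then show ?thesis
    using assms by (simp add: window_def)
qed

text \<open>The bump centred at \<xi> with radius \<open>\<epsilon>\<close> is a test function whose
  support misses \<open>{-\<sigma>..\<sigma>}\<close>, so the distributional transform of
  \<open>f\<close> annihilates it.\<close>

lemma fourier_windowed_eq_0:
  assumes f: "f \<in> borel_measurable lborel" "integrable lborel (\<lambda>x. norm (f x) powr r)" "r \<ge> 1"
    and supp: "distribution_support (fourier_distribution (regular_distribution f)) \<subseteq> {-\<sigma>..\<sigma>}"
    and \<epsilon>: "\<epsilon> > 0" and \<xi>: "\<bar>\<xi>\<bar> > \<sigma> + \<epsilon>"
  shows "fourier (\<lambda>x. f x * window (\<epsilon> * x)) \<xi> = 0"
proof -
  define \<eta> where "\<eta> \<zeta> = complex_of_real (bump ((\<zeta> - \<xi>) / \<epsilon>))" for \<zeta>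
  have eta0: "\<eta> \<zeta> = 0" if "\<zeta> \<notin> {\<xi> - \<epsilon>..\<xi> + \<epsilon>}" for \<zeta>
  proof -
    have "\<bar>(\<zeta> - \<xi>) / \<epsilon>\<bar> \<ge> 1" using that \<epsilon> by (auto simp: abs_if field_simps)
    then show ?thesis by (simp add: \<eta>_def bump_eq_0)
  qed
  have "Ck n \<eta>" for n
    using Ck_affine[OF Ck_bump[of n], of "1 / \<epsilon>" "- \<xi> / \<epsilon>"]
    by (simp add: \<eta>_def[abs_def] diff_divide_distrib)
  then have "test_function \<eta>"
    using eta0 by (rule test_functionI)
  moreover have "fun_support \<eta> \<subseteq> {\<xi> - \<epsilon>..\<xi> + \<epsilon>}"
    using eta0 by (intro fun_support_subset) auto
  then have "distribution_support (fourier_distribution (regular_distribution f)) \<inter> fun_support \<eta> = {}"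
    using supp \<xi> by fastforce
  ultimately have "fourier_distribution (regular_distribution f) \<eta> = 0"
    by (rule fourier_distribution_eq_0[OF f])
  then have *: "(LINT x|lborel. f x * fourier \<eta> x) = 0"
    by (simp add: fourier_distribution_def regular_distribution_def)
  have "(\<lambda>x. f x * window (\<epsilon> * x) * exp (- (\<i> * complex_of_real x * complex_of_real \<xi>))) =
     (\<lambda>x. f x * fourier \<eta> x / (of_real \<epsilon> * fourier (\<lambda>\<zeta>. of_real (bump \<zeta>)) 0))"
    using window_eq_fourier[OF \<epsilon>, of _ \<xi>] by (simp add: \<eta>_def[abs_def] mult.assoc)
  then show ?thesis
    unfolding fourier_def[of "\<lambda>x. f x * window (\<epsilon> * x)"] using * by simp
qed

lemma integrable_windowed:
  assumes f: "f \<in> borel_measurable lborel" "integrable lborel (\<lambda>x. norm (f x) powr r)" "r \<ge> 1"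
    and \<epsilon>: "0 < \<epsilon>" "\<epsilon> \<le> 1"
  shows "integrable lborel (\<lambda>x. f x * window (\<epsilon> * x))"
proof -
  obtain C where C: "\<And>x. norm (window x) \<le> C / (1 + x\<^sup>2)"
    using window_decay by blast
  have C0: "C \<ge> 0" using order_trans[OF norm_ge_zero C[of 0]] by simp
  have "norm (window (\<epsilon> * x)) \<le> (C / \<epsilon>\<^sup>2) / (1 + x\<^sup>2)" for x
  proof -
    \<comment> \<open>The bound \<open>\<epsilon> \<le> 1\<close> lets the decay of the dilated
      window be compared with \<open>1 + x\<^sup>2\<close> at the price of the factor
      \<open>1 / \<epsilon>\<^sup>2\<close>.\<close>
    have "\<epsilon>\<^sup>2 * (1 + x\<^sup>2) \<le> 1 + (\<epsilon> * x)\<^sup>2"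
      using \<epsilon> power_le_one[of \<epsilon> 2] by (simp add: distrib_left power_mult_distrib)
    then have "C / (1 + (\<epsilon> * x)\<^sup>2) \<le> C / (\<epsilon>\<^sup>2 * (1 + x\<^sup>2))"
      using C0 \<epsilon> by (intro divide_left_mono mult_pos_pos) (auto simp: add_pos_nonneg)
    with C[of "\<epsilon> * x"] show ?thesis by simp
  qed
  moreover have "(\<lambda>x. window (\<epsilon> * x)) \<in> borel_measurable lborel"
    using continuous_on_compose2[OF continuous_window, of UNIV "\<lambda>x. \<epsilon> * x"]
    by (auto intro!: borel_measurable_continuous_onI continuous_intros)
  ultimately show ?thesis
    using f by (intro integrable_mult_decay)
qed

text \<open>The estimate for band \<open>\<sigma> + \<epsilon> n\<close> holds for every
  \<open>n\<close>; finitely many samples converge because the window is continuous with value 1 at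
  0, and the constant converges as well.\<close>

lemma bernstein_sampling_le:
  assumes f: "f \<in> borel_measurable lborel" "integrable lborel (\<lambda>x. norm (f x) powr r)" "r \<ge> 1"
    and cont: "continuous_on UNIV f"
    and supp: "distribution_support (fourier_distribution (regular_distribution f)) \<subseteq> {-\<sigma>..\<sigma>}"
    and \<sigma>: "\<sigma> > 0" and h: "h > 0" and K: "finite K"
  shows "(\<Sum>k\<in>K. h * norm (f (x - of_int k * h)) powr r) \<le>
    (1 + h * \<sigma>) powr r * (LINT x|lborel. norm (f x) powr r)"
proof -
  define I where "I = (LINT x|lborel. norm (f x) powr r)"
  define \<epsilon> where "\<epsilon> n = 1 / real (Suc n)" for n
  have \<epsilon>0: "\<epsilon> \<longlonglongrightarrow> 0"
    unfolding \<epsilon>_def by (intro LIMSEQ_Suc lim_const_over_n)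
  have \<epsilon>: "0 < \<epsilon> n" "\<epsilon> n \<le> 1" for n by (simp_all add: \<epsilon>_def)
  define u where "u n x = f x * window (\<epsilon> n * x)" for n x
  have "(\<Sum>k\<in>K. h * norm (u n (x - of_int k * h)) powr r) \<le> (1 + h * (\<sigma> + \<epsilon> n)) powr r * I" for n
  proof -
    have "continuous_on UNIV (u n)"
      unfolding u_def
      by (intro continuous_on_mult cont continuous_on_compose2[OF continuous_window]) (auto intro!: continuous_intros)
    moreover have "integrable lborel (u n)"
      unfolding u_def by (intro integrable_windowed[OF f] \<epsilon>)
    moreover have "fourier (u n) \<xi> = 0" if "\<bar>\<xi>\<bar> > \<sigma> + \<epsilon> n" for \<xi>
      unfolding u_def by (intro fourier_windowed_eq_0[OF f supp \<epsilon>(1) that])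
    ultimately have "(\<Sum>k\<in>K. ennreal (h * norm (u n (x - of_int k * h)) powr r)) \<le>
      ennreal ((1 + h * (\<sigma> + \<epsilon> n)) powr r) * (\<integral>\<^sup>+ z. ennreal (norm (u n z) powr r) \<partial>lborel)"
      using \<sigma> \<epsilon>[of n] f(3) h K by (intro band_limited_sampling) auto
    \<comment> \<open>The right-hand side is made independent of the window, so that in the limit
      only the constant moves.\<close>
    also have "\<dots> \<le> ennreal ((1 + h * (\<sigma> + \<epsilon> n)) powr r) * (\<integral>\<^sup>+ z. ennreal (norm (f z) powr r) \<partial>lborel)"
      using norm_window_le f(3)
      by (intro mult_left_mono nn_integral_mono ennreal_leI powr_mono2) (auto simp: u_def norm_mult mult_left_le)
    also have "(\<integral>\<^sup>+ z. ennreal (norm (f z) powr r) \<partial>lborel) = ennreal I"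
      unfolding I_def by (intro nn_integral_eq_integral f(2)) auto
    finally show ?thesis
      using h by (simp add: sum_nonneg ennreal_mult[symmetric] I_def integral_nonneg_AE)
  qed
  moreover have "(\<lambda>n. \<Sum>k\<in>K. h * norm (u n (x - of_int k * h)) powr r) \<longlonglongrightarrow> (\<Sum>k\<in>K. h * norm (f (x - of_int k * h)) powr r)"
  proof (intro tendsto_sum tendsto_mult tendsto_const)
    fix k
    define y where "y = x - of_int k * h"
    have "isCont window 0"
      using continuous_window by (simp add: continuous_on_eq_continuous_at)
    moreover have "(\<lambda>n. \<epsilon> n * y) \<longlonglongrightarrow> 0"
      using tendsto_mult[OF \<epsilon>0 tendsto_const[of y]] by simp
    ultimately have "(\<lambda>n. window (\<epsilon> n * y)) \<longlonglongrightarrow> window 0"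
      by (rule isCont_tendsto_compose)
    then have "(\<lambda>n. u n y) \<longlonglongrightarrow> f y * 1"
      unfolding u_def window_0 by (intro tendsto_mult tendsto_const)
    then have "(\<lambda>n. norm (u n y)) \<longlonglongrightarrow> norm (f y)"
      by (intro tendsto_norm) simp
    then have "(\<lambda>n. norm (u n y) powr r) \<longlonglongrightarrow> norm (f y) powr r"
      using f(3) by (intro tendsto_powr2 tendsto_const) auto
    then show "(\<lambda>n. norm (u n (x - of_int k * h)) powr r) \<longlonglongrightarrow> norm (f (x - of_int k * h)) powr r"
      by (simp add: y_def)
  qed
  moreover have "(\<lambda>n. (1 + h * (\<sigma> + \<epsilon> n)) powr r * I) \<longlonglongrightarrow> (1 + h * (\<sigma> + 0)) powr r * I"
    using \<sigma> h f(3) by (intro tendsto_intros \<epsilon>0) (auto simp: add_pos_pos less_imp_neq[symmetric])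
  ultimately have "(\<Sum>k\<in>K. h * norm (f (x - of_int k * h)) powr r) \<le> (1 + h * (\<sigma> + 0)) powr r * I"
    using LIMSEQ_le by blast
  then show ?thesis by (simp add: I_def)
qed

text \<open>The translates of one cell tile the line, so the periodization has over
  \<open>{0..<h}\<close> the same integral as \<open>v\<close> over the line. A bound by
  \<open>M\<close> on a cell of length \<open>h\<close> gives \<open>h * M\<close>, and
  \<open>h\<close> cancels.\<close>

lemma nn_integral_le_of_periodization_le:
  fixes v :: "real \<Rightarrow> ennreal"
  assumes [measurable]: "v \<in> borel_measurable borel" and h: "h > 0"
    and le: "\<And>y. ennreal h * (\<Sum>\<^sub>\<infinity>k::int. v (y - of_int k * h)) \<le> M"
  shows "(\<integral>\<^sup>+ x. v x \<partial>lborel) \<le> M"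
proof -
  \<comment> \<open>The integers are enumerated by \<open>int_decode\<close> so that sum and
    integral can be exchanged by monotone convergence. As \<open>y\<close> runs through
    \<open>{0..<h}\<close>, the point \<open>y - c n\<close> runs through
    \<open>J n\<close>.\<close>
  define c where "c n = of_int (int_decode n) * h" for n
  define J where "J n = {- c n..<- c n + h}" for n
  have [measurable]: "J n \<in> sets borel" for n by (simp add: J_def)
  have "disjoint_family J"
    unfolding disjoint_family_on_def
  proof (intro ballI impI, rule ccontr)
    fix m n assume "m \<noteq> n" "J m \<inter> J n \<noteq> {}"
    then have "\<bar>c m - c n\<bar> < h" by (auto simp: J_def)
    moreover have "\<bar>c m - c n\<bar> = \<bar>of_int (int_decode m - int_decode n)\<bar> * h"
      using h by (simp add: c_def abs_mult flip: left_diff_distrib)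
    ultimately have "\<bar>of_int (int_decode m - int_decode n) :: real\<bar> < 1"
      using h by simp
    then have "int_decode m = int_decode n" by linarith
    with \<open>m \<noteq> n\<close> show False
      using bij_int_decode by (auto dest: bij_is_inj injD)
  qed
  moreover have "(\<Union>n. J n) = UNIV"
  proof -
    have "\<exists>n. z \<in> J n" for z
    proof -
      obtain n where n: "int_decode n = - \<lfloor>z / h\<rfloor>"
        using bij_int_decode by (metis bij_pointE)
      have "of_int \<lfloor>z / h\<rfloor> * h \<le> (z / h) * h" "(z / h) * h < (of_int \<lfloor>z / h\<rfloor> + 1) * h"
        using h by (intro mult_right_mono mult_strict_right_mono; linarith)+
      then show ?thesis
        using h by (intro exI[of _ n]) (simp add: J_def c_def n algebra_simps)
    qed
    then show ?thesis by auto
  qed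
  ultimately have one: "(\<Sum>n. indicator (J n) z) = (1 :: ennreal)" for z
    by (simp add: suminf_indicator)
  \<comment> \<open>Each partial sum is a finite subsum of the unordered sum over the
    integers.\<close>
  have sum_le: "(\<Sum>n. v (y - c n)) \<le> (\<Sum>\<^sub>\<infinity>k::int. v (y - of_int k * h))" for y
    unfolding suminf_eq_SUP
  proof (rule SUP_least)
    fix N
    have "(\<Sum>n<N. v (y - c n)) = (\<Sum>k\<in>int_decode ` {..<N}. v (y - of_int k * h))"
      using bij_int_decode by (subst sum.reindex) (auto simp: c_def dest: bij_is_inj intro: inj_on_subset)
    also have "\<dots> \<le> (\<Sum>\<^sub>\<infinity>k::int. v (y - of_int k * h))"
      by (subst nonneg_infsum_complete) (auto intro!: SUP_upper)
    finally show "(\<Sum>n<N. v (y - c n)) \<le> (\<Sum>\<^sub>\<infinity>k::int. v (y - of_int k * h))" .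
  qed
  have shift: "(\<integral>\<^sup>+ z. v z * indicator (J n) z \<partial>lborel) = (\<integral>\<^sup>+ y. v (y - c n) * indicator {0..<h} y \<partial>lborel)" for n
  proof -
    have "(\<integral>\<^sup>+ z. v z * indicator (J n) z \<partial>lborel) = (\<integral>\<^sup>+ y. v (y + - c n) * indicator (J n) (y + - c n) \<partial>lborel)"
      by (rule nn_integral_translate[symmetric]) measurable
    also have "\<dots> = (\<integral>\<^sup>+ y. v (y - c n) * indicator {0..<h} y \<partial>lborel)"
      by (intro nn_integral_cong) (auto simp: J_def indicator_def)
    finally show ?thesis .
  qed
  have "(\<integral>\<^sup>+ z. v z \<partial>lborel) = (\<integral>\<^sup>+ z. (\<Sum>n. v z * indicator (J n) z) \<partial>lborel)"
    by (simp add: one)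
  also have "\<dots> = (\<Sum>n. \<integral>\<^sup>+ z. v z * indicator (J n) z \<partial>lborel)"
    by (rule nn_integral_suminf) measurable
  also have "\<dots> = (\<integral>\<^sup>+ y. (\<Sum>n. v (y - c n) * indicator {0..<h} y) \<partial>lborel)"
    unfolding shift by (rule nn_integral_suminf[symmetric]) measurable
  also have "\<dots> = (\<integral>\<^sup>+ y. (\<Sum>n. v (y - c n)) * indicator {0..<h} y \<partial>lborel)"
    by simp
  finally have "ennreal h * (\<integral>\<^sup>+ z. v z \<partial>lborel) = (\<integral>\<^sup>+ y. ennreal h * ((\<Sum>n. v (y - c n)) * indicator {0..<h} y) \<partial>lborel)"
    by (simp add: nn_integral_cmult)
  also have "\<dots> \<le> (\<integral>\<^sup>+ y. M * indicator {0..<h} y \<partial>lborel)"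
  proof (rule nn_integral_mono)
    fix y
    have "ennreal h * (\<Sum>n. v (y - c n)) \<le> M"
      using mult_left_mono[OF sum_le[of y], of "ennreal h"] le[of y] by (auto intro: order_trans)
    then show "ennreal h * ((\<Sum>n. v (y - c n)) * indicator {0..<h} y) \<le> M * indicator {0..<h} y"
      by (simp add: mult_right_mono mult.assoc[symmetric])
  qed
  also have "\<dots> = ennreal h * M"
    using h by (simp add: nn_integral_cmult mult.commute)
  finally show ?thesis
    using h by (subst (asm) ennreal_mult_le_mult_iff) auto
qed

section \<open>Roots of extended nonnegative reals and the two inequalities\<close>

lemma epowr_ennreal: "a \<ge> 0 \<Longrightarrow> epowr (ennreal a) r = ennreal (a powr r)"
  by (simp add: epowr_def)

lemma epowr_mono:
  assumes "a \<le> b" "r \<ge> 0"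
  shows "epowr a r \<le> epowr b r"
proof (cases b)
  case (real y)
  with assms obtain x where "a = ennreal x" "x \<ge> 0" by (cases a) (auto simp: top_unique)
  with real assms show ?thesis
    by (simp add: epowr_ennreal powr_mono2)
qed (simp add: epowr_def)

lemma epowr_epowr_inverse:
  assumes "r > 0"
  shows "epowr (epowr a r) (1 / r) = a" "epowr (epowr a (1 / r)) r = a"
  using assms by (cases a; simp add: epowr_ennreal powr_powr; simp add: epowr_def)+

theorem theorem3p2:
  fixes p :: ennreal and \<sigma> h :: real and f :: "real \<Rightarrow> complex" and t :: "int \<Rightarrow> real"
  assumes "1 \<le> p"
    and "\<sigma> > 0"
    and "f \<in> bernstein p \<sigma>"
    and "h > 0"
    and "\<And>k. t k = of_int k * h"
  shows "Lp_norm p f \<le> sampling_sup p h t f \<and>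
         sampling_sup p h t f \<le> ennreal (1 + h * \<sigma>) * Lp_norm p f"
proof -
  have f: "f \<in> borel_measurable lborel" "Lp_norm p f < \<infinity>" "smooth f"
    and supp: "distribution_support (fourier_distribution (regular_distribution f)) \<subseteq> {-\<sigma>..\<sigma>}"
    using assms(3) by (auto simp: bernstein_def Lp_space_def)
  have cont: "continuous_on UNIV f"
    using f(3) by (rule smooth_continuous_on)
  have [measurable]: "f \<in> borel_measurable borel" using f(1) by simp
  show ?thesis
  proof (cases "p = \<infinity>")
    \<comment> \<open>The index 0 recovers \<open>f x\<close> from the samples, and continuity makes
      the essential supremum a pointwise bound, so \<open>E\<close> and \<open>S\<close> coincide;
      the factor is at least 1.\<close>
    case True
    define S where "S = (SUP x. SUP k. ennreal (norm (f (x - t k))))"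
    define E where "E = esssup lborel (\<lambda>x. ennreal (norm (f x)))"
    have "ennreal (norm (f x)) \<le> S" for x
    proof -
      have "ennreal (norm (f x)) \<le> (SUP k. ennreal (norm (f (x - t k))))"
        by (rule SUP_upper2[of 0]) (simp_all add: assms(5))
      also have "\<dots> \<le> S"
        unfolding S_def by (rule SUP_upper) simp
      finally show ?thesis .
    qed
    then have "E \<le> S"
      unfolding E_def by (intro esssup_I) auto
    have "ennreal (norm (f x)) \<le> E" for x
      by (rule continuous_le_if_AE_le[of "\<lambda>x. norm (f x)"])
        (use cont esssup_AE in \<open>auto simp: E_def intro: continuous_on_norm\<close>)
    then have "S \<le> E"
      unfolding S_def by (intro SUP_least)
    also have "E = 1 * E" by simp
    also have "\<dots> \<le> ennreal (1 + h * \<sigma>) * E"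
      using assms(2,4) by (intro mult_right_mono) (simp_all add: ennreal_le_iff flip: ennreal_1)
    finally show ?thesis
      using \<open>E \<le> S\<close> True by (simp add: sampling_sup_def Lp_norm_def S_def E_def)
  next
    case False
    define r where "r = enn2real p"
    have pr: "p = ennreal r" using False by (simp add: r_def less_top)
    have r: "r \<ge> 1"
      using assms(1) unfolding pr by simp
    define v where "v x = ennreal (norm (f x) powr r)" for x
    have [measurable]: "v \<in> borel_measurable borel"
      unfolding v_def by measurable
    define N where "N = (\<integral>\<^sup>+ x. v x \<partial>lborel)"
    define S where "S x = ennreal h * (\<Sum>\<^sub>\<infinity>k. v (x - of_int k * h))" for x
    have Lp: "Lp_norm p f = epowr N (1 / r)"
      using False by (simp add: Lp_norm_def r_def N_def v_def)
    have samp: "sampling_sup p h t f = (SUP x. epowr (S x) (1 / r))"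
      using False by (simp add: sampling_sup_def r_def S_def v_def assms(5))
    have "Lp_norm p f \<le> sampling_sup p h t f"
    proof -
      define A where "A = (SUP x. epowr (S x) (1 / r))"
      \<comment> \<open>Undoing the root gives a bound on the periodization that is uniform in
        \<open>x\<close>, as the period argument requires.\<close>
      have "S x \<le> epowr A r" for x
      proof -
        have "epowr (S x) (1 / r) \<le> A"
          unfolding A_def by (rule SUP_upper) simp
        then have "epowr (epowr (S x) (1 / r)) r \<le> epowr A r"
          using r by (intro epowr_mono) auto
        then show ?thesis using r by (simp add: epowr_epowr_inverse)
      qed
      then have "N \<le> epowr A r"
        unfolding N_def S_def using assms(4) by (intro nn_integral_le_of_periodization_le) auto
      then have "epowr N (1 / r) \<le> epowr (epowr A r) (1 / r)"
        using r by (intro epowr_mono) auto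
      then show ?thesis
        using r by (simp add: Lp samp A_def epowr_epowr_inverse)
    qed
    moreover have "sampling_sup p h t f \<le> ennreal (1 + h * \<sigma>) * Lp_norm p f"
    proof -
      \<comment> \<open>Finiteness of the norm is what allows real integrals and limits in place of
        extended ones.\<close>
      have "N < \<infinity>"
        using f(2) unfolding Lp by (auto simp: epowr_def less_top split: if_splits)
      then have int: "integrable lborel (\<lambda>x. norm (f x) powr r)"
        unfolding N_def v_def by (intro integrableI_nonneg) auto
      define I where "I = (LINT x|lborel. norm (f x) powr r)"
      have I: "I \<ge> 0" unfolding I_def by (intro integral_nonneg_AE) auto
      have NI: "N = ennreal I"
        unfolding N_def v_def I_def by (intro nn_integral_eq_integral int) auto
      have "epowr (S x) (1 / r) \<le> ennreal (1 + h * \<sigma>) * Lp_norm p f" for x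
      proof -
        have "ennreal h * (\<Sum>k\<in>K. v (x - of_int k * h)) \<le> ennreal ((1 + h * \<sigma>) powr r * I)" if "finite K" for K
        proof -
          have "ennreal h * (\<Sum>k\<in>K. v (x - of_int k * h)) = ennreal (\<Sum>k\<in>K. h * norm (f (x - of_int k * h)) powr r)"
            using assms(4) by (simp add: v_def sum_distrib_left[symmetric] ennreal_mult sum_nonneg)
          also have "\<dots> \<le> ennreal ((1 + h * \<sigma>) powr r * I)"
            unfolding I_def
            by (intro ennreal_leI bernstein_sampling_le[OF f(1) int r cont supp assms(2,4) that])
          finally show ?thesis .
        qed
        \<comment> \<open>In \<open>ennreal\<close> the unordered sum is the supremum of its finite
          subsums, so the estimate for finite \<open>K\<close> is enough.\<close>
        then have "S x \<le> ennreal ((1 + h * \<sigma>) powr r * I)"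
          unfolding S_def by (subst nonneg_infsum_complete) (auto simp: SUP_mult_left_ennreal intro!: SUP_least)
        then have "epowr (S x) (1 / r) \<le> ennreal (((1 + h * \<sigma>) powr r * I) powr (1 / r))"
          using epowr_mono[of "S x" "ennreal ((1 + h * \<sigma>) powr r * I)" "1 / r"] r I
          by (simp add: epowr_ennreal)
        also have "((1 + h * \<sigma>) powr r * I) powr (1 / r) = (1 + h * \<sigma>) * I powr (1 / r)"
          using assms(2,4) r I by (simp add: powr_mult powr_powr)
        also have "ennreal \<dots> = ennreal (1 + h * \<sigma>) * Lp_norm p f"
          using assms(2,4) I by (simp add: Lp NI epowr_ennreal ennreal_mult)
        finally show ?thesis .
      qed
      then show ?thesis
        unfolding samp by (rule SUP_least)
    qed
    ultimately show ?thesis ..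
  qed
qed

end
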